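(* Let $a,b$ be positive integers and $n$ a nonnegative integer, and let $H_{a,b}$ be the graph defined below. Then there are bijections between the following three sets: (1) downs-first cycles in $H_{a,b}$ of length $(a+b)n$ beginning at the origin $(0,0)$; (2) balanced origin-connected weight functions on $H_{a,b}$ with total weight sum $(a+b)n$; (3) ordered sequences of $n$ lap cycles in $H_{a,b}$ beginning at the origin.
   Context: $G_{a,b}$ is the directed graph whose vertices are the pairs $(x,y)\in\mathbb{Z}_{a+b}\times\mathbb{Z}$ with $y\equiv ax\pmod{a+b}$. From each vertex $(x,y)$ there is an up-edge $(x,y)\to(x+1,y+a)$ and a down-edge $(x,y)\to(x+1,y-b)$ ($x+1$ computed in $\mathbb{Z}_{a+b}$). Vertices with $x=0$ are weld points. Representing $x\in\{0,1,\dots,a+b-1\}$, let $h(x)=ax$ for $0\le x\le b$ and $h(x)=ab-b(x-b)$ for $b\le x\le a+b-1$ (so $h$ traces the highest lap cycle from the origin: $b$ up-steps followed by $a$ down-steps). $H_{a,b}$ is the subgraph of $G_{a,b}$ induced on the vertices $(x,y)$ with $y\le h(x)$, i.e. $G_{a,b}$ with all points lying above the highest lap cycle from the origin removed (in particular all weld points $(0,y)$ with $y>0$ are removed), together with all edges of $G_{a,b}$ between remaining vertices. A path is a sequence of vertices $v_0\cdots v_m$ with an edge from $v_{i-1}$ to $v_i$ for each $i$ (repetitions allowed), of length $m$; it is a cycle if $v_0=v_m$. A path is downs-first if for every vertex, all down-steps of the path leaving that vertex occur before all up-steps leaving it. A lap is a path of length $a+b$ that starts and ends at weld points; a lap cycle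 is a lap that is a cycle. A weight function on $H_{a,b}$ assigns a nonnegative integer to each edge of $H_{a,b}$; the in-weight (out-weight) of a vertex is the sum of weights of edges entering (leaving) it; it is balanced if in-weight equals out-weight at every vertex; a path is covered by the weight function if each edge is used by the path at most as many times as its weight; the weight function is origin-connected if for every vertex with positive out-weight there is a covered path from the origin to that vertex. *)

theory Defs
  imports "Graph_Theory.Digraph_Component" "Graph_Theory.Vertex_Walk"
    "HOL-Number_Theory.Cong"
begin

text \<open>
  Elements of \<open>\<int>\<^bsub>a+b\<^esub>\<close> are represented by the natural numbers below \<open>a + b\<close>.
\<close>

type_synonym vertex = "nat \<times> int"
type_synonym edge = "vertex \<times> vertex"

definition up_nbr :: "nat \<Rightarrow> nat \<Rightarrow> vertex \<Rightarrow> vertex" where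
  "up_nbr a b v = ((fst v + 1) mod (a + b), snd v + int a)"

definition down_nbr :: "nat \<Rightarrow> nat \<Rightarrow> vertex \<Rightarrow> vertex" where
  "down_nbr a b v = ((fst v + 1) mod (a + b), snd v - int b)"

definition G_verts :: "nat \<Rightarrow> nat \<Rightarrow> vertex set" where
  "G_verts a b = {(x, y). x < a + b \<and> [y = int a * int x] (mod int (a + b))}"

text \<open>
  For \<open>a + b > 0\<close> the up-neighbour and the down-neighbour of a vertex are distinct, so an edge is
  determined by its two end points and can be represented as a pair of vertices.
\<close>

definition G_graph :: "nat \<Rightarrow> nat \<Rightarrow> (vertex, edge) pre_digraph" where
  "G_graph a b =
     \<lparr> verts = G_verts a b,
       arcs = {(v, up_nbr a b v) | v. v \<in> G_verts a b} \<union> {(v, down_nbr a b v) | v. v \<in> G_verts a b},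
       tail = fst, head = snd \<rparr>"

definition height :: "nat \<Rightarrow> nat \<Rightarrow> nat \<Rightarrow> int" where
  "height a b x =
     (if x \<le> b then int a * int x else int a * int b - int b * (int x - int b))"

definition H_graph :: "nat \<Rightarrow> nat \<Rightarrow> (vertex, edge) pre_digraph" where
  "H_graph a b = G_graph a b \<restriction> {v \<in> verts (G_graph a b). snd v \<le> height a b (fst v)}"

definition origin :: vertex where
  "origin = (0, 0)"

definition weld_point :: "vertex \<Rightarrow> bool" where
  "weld_point v \<longleftrightarrow> fst v = 0"

text \<open>
  Paths, with repetitions allowed, are the vertex walks of the library, and \<open>vwalk_length\<close> is
  the number of steps.  The one-vertex walk is a cycle of length \<open>0\<close>.
\<close>

definition cycle_walk :: "(vertex, edge) pre_digraph \<Rightarrow> vertex list \<Rightarrow> bool" where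
  "cycle_walk G p \<longleftrightarrow> vwalk p G \<and> hd p = last p"

definition downs_first :: "nat \<Rightarrow> nat \<Rightarrow> vertex list \<Rightarrow> bool" where
  "downs_first a b p \<longleftrightarrow>
     (\<forall>v i j. i < vwalk_length p \<and> p ! i = v \<and> p ! (i + 1) = down_nbr a b v \<and>
              j < vwalk_length p \<and> p ! j = v \<and> p ! (j + 1) = up_nbr a b v \<longrightarrow> i < j)"

definition lap :: "nat \<Rightarrow> nat \<Rightarrow> (vertex, edge) pre_digraph \<Rightarrow> vertex list \<Rightarrow> bool" where
  "lap a b G p \<longleftrightarrow>
     vwalk p G \<and> vwalk_length p = a + b \<and> weld_point (hd p) \<and> weld_point (last p)"

definition lap_cycle :: "nat \<Rightarrow> nat \<Rightarrow> (vertex, edge) pre_digraph \<Rightarrow> vertex list \<Rightarrow> bool" where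
  "lap_cycle a b G p \<longleftrightarrow> lap a b G p \<and> cycle_walk G p"

text \<open>
  A weight function is defined on the edges of the graph only; as a total function it is
  normalised to \<open>0\<close> on all other pairs of vertices.
\<close>

definition weight_function :: "(vertex, edge) pre_digraph \<Rightarrow> (edge \<Rightarrow> nat) \<Rightarrow> bool" where
  "weight_function G w \<longleftrightarrow> (\<forall>e. e \<notin> arcs G \<longrightarrow> w e = 0)"

definition in_weight :: "(vertex, edge) pre_digraph \<Rightarrow> (edge \<Rightarrow> nat) \<Rightarrow> vertex \<Rightarrow> nat" where
  "in_weight G w v = (\<Sum>e\<in>in_arcs G v. w e)"

definition out_weight :: "(vertex, edge) pre_digraph \<Rightarrow> (edge \<Rightarrow> nat) \<Rightarrow> vertex \<Rightarrow> nat" where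
  "out_weight G w v = (\<Sum>e\<in>out_arcs G v. w e)"

definition balanced :: "(vertex, edge) pre_digraph \<Rightarrow> (edge \<Rightarrow> nat) \<Rightarrow> bool" where
  "balanced G w \<longleftrightarrow> (\<forall>v\<in>verts G. in_weight G w v = out_weight G w v)"

definition covered :: "(vertex, edge) pre_digraph \<Rightarrow> (edge \<Rightarrow> nat) \<Rightarrow> vertex list \<Rightarrow> bool" where
  "covered G w p \<longleftrightarrow> (\<forall>e\<in>arcs G. count_list (vwalk_arcs p) e \<le> w e)"

definition origin_connected :: "(vertex, edge) pre_digraph \<Rightarrow> (edge \<Rightarrow> nat) \<Rightarrow> bool" where
  "origin_connected G w \<longleftrightarrow>
     (\<forall>v\<in>verts G. out_weight G w v > 0 \<longrightarrow>
        (\<exists>p. vwalk p G \<and> hd p = origin \<and> last p = v \<and> covered G w p))"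

text \<open>
  The graph has infinitely many edges, and \<open>sum\<close> is \<open>0\<close> on infinite sets.  A family of natural
  numbers has a finite sum exactly if its support is finite, so finiteness is required explicitly.
\<close>

definition has_total_weight :: "(vertex, edge) pre_digraph \<Rightarrow> (edge \<Rightarrow> nat) \<Rightarrow> nat \<Rightarrow> bool" where
  "has_total_weight G w N \<longleftrightarrow>
     finite {e \<in> arcs G. w e \<noteq> 0} \<and> (\<Sum>e\<in>{e \<in> arcs G. w e \<noteq> 0}. w e) = N"

definition downs_first_cycles :: "nat \<Rightarrow> nat \<Rightarrow> nat \<Rightarrow> vertex list set" where
  "downs_first_cycles a b n =
     {p. cycle_walk (H_graph a b) p \<and> hd p = origin \<and> vwalk_length p = (a + b) * n \<and>
         downs_first a b p}"

definition balanced_weightings :: "nat \<Rightarrow> nat \<Rightarrow> nat \<Rightarrow> (edge \<Rightarrow> nat) set" where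
  "balanced_weightings a b n =
     {w. weight_function (H_graph a b) w \<and> balanced (H_graph a b) w \<and>
         origin_connected (H_graph a b) w \<and> has_total_weight (H_graph a b) w ((a + b) * n)}"

definition lap_cycle_sequences :: "nat \<Rightarrow> nat \<Rightarrow> nat \<Rightarrow> vertex list list set" where
  "lap_cycle_sequences a b n =
     {ps. length ps = n \<and> (\<forall>p\<in>set ps. lap_cycle a b (H_graph a b) p \<and> hd p = origin)}"

end

theory Submission
  imports Defs
begin

text \<open>
  In each column the heights of the vertices are congruent modulo \<open>a + b\<close>, and the heads of the two
  edges leaving a vertex also differ by \<open>a + b\<close>; hence paths may merge but never properly cross.  A balanced weight
  function is therefore a sum of lap cycles \<open>L\<^sub>1 \<ge> L\<^sub>2 \<ge> \<dots>\<close>, where \<open>L\<^sub>1\<close> consists of the highest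
  vertex of the support in each column, and it is origin-connected iff \<open>L\<^sub>1\<close> passes through the origin
  and each \<open>L\<^sub>i\<close> touches its predecessor.  As a lap cycle has exactly one vertical translate that
  touches a given lap cycle from below, the sequence of the \<open>L\<^sub>i\<close> translated to the origin is arbitrary.

  A downs-first cycle is determined by its edge multiplicities.  Conversely, leave each vertex downwards
  as long as the weights permit it and upwards afterwards, until the walk gets stuck, necessarily at the
  origin.  If weight were left over, the highest lap of the rest would run below the origin, and no edge
  of the weight function would leave it upwards; then none could enter it from above either, contrary
  to origin-connectedness.
\<close>

section \<open>Auxiliary facts on divisibility, walks, lists and bijections\<close>

lemma dvd_between:
  fixes m u v :: int
  assumes "m dvd u - v" and "v < u" and "m > 0"
  shows "v + m \<le> u"
  using assms zdvd_imp_le by fastforce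

lemma reach_vwalk:
  assumes "vwalk p G" and "set (vwalk_arcs p) \<subseteq> R"
  shows "(hd p, last p) \<in> R\<^sup>*"
  using assms
proof (induction rule: vwalk_induct)
  case (Cons u v es)
  then show ?case by (auto intro: converse_rtrancl_into_rtrancl)
qed simp

lemma distinct_vwalk_arcs:
  assumes "distinct p"
  shows "distinct (vwalk_arcs p)"
  using assms by (induction p rule: vwalk_arcs.induct) (auto dest: arcs_in_vwalk_arcs)

lemma count_list_le_1:
  assumes "distinct xs"
  shows "count_list xs x \<le> 1"
  using assms by (induction xs) auto

lemma vwalk_arcs_eq_map: "vwalk_arcs p = map (\<lambda>i. (p ! i, p ! (i + 1))) [0..<length p - 1]"
proof (induction p rule: vwalk_arcs.induct)
  case (3 u v es)
  have "[0..<length (u # v # es) - 1] = 0 # map Suc [0..<length (v # es) - 1]"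
    by (simp add: map_Suc_upt upt_conv_Cons del: upt_Suc)
  then show ?case using 3 by simp
qed simp_all

lemma bij_betw_map_lists_length:
  assumes "bij_betw f A B"
  shows "bij_betw (map f) {xs. length xs = n \<and> set xs \<subseteq> A} {ys. length ys = n \<and> set ys \<subseteq> B}"
  unfolding bij_betw_def
proof
  show "inj_on (map f) {xs. length xs = n \<and> set xs \<subseteq> A}"
    using assms by (intro inj_onI) (auto simp: bij_betw_def intro!: list.inj_map_strong[of _ _ f f] dest: inj_onD)
  show "map f ` {xs. length xs = n \<and> set xs \<subseteq> A} = {ys. length ys = n \<and> set ys \<subseteq> B}"
  proof (intro equalityI subsetI)
    fix ys assume ys: "ys \<in> {ys. length ys = n \<and> set ys \<subseteq> B}"
    then have "ys \<in> lists (f ` A)" using assms by (auto simp: bij_betw_def)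
    then obtain xs where "ys = map f xs" "xs \<in> lists A" unfolding lists_image by blast
    then show "ys \<in> map f ` {xs. length xs = n \<and> set xs \<subseteq> A}" using ys by auto
  next
    fix ys assume "ys \<in> map f ` {xs. length xs = n \<and> set xs \<subseteq> A}"
    then show "ys \<in> {ys. length ys = n \<and> set ys \<subseteq> B}"
      using assms by (auto simp: bij_betw_def subset_iff)
  qed
qed

section \<open>Circulations and laps\<close>

text \<open>
  Columns are indexed by all natural numbers, with \<open>x\<close> and \<open>x + a + b\<close> denoting the same column;
  laps are accordingly periodic functions.
\<close>

locale slopes =
  fixes a b :: nat
  assumes a_pos: "a > 0" and b_pos: "b > 0"
begin

abbreviation period :: nat where "period \<equiv> a + b"

definition pt :: "nat \<Rightarrow> int \<Rightarrow> vertex" where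
  "pt x y = (x mod period, y)"

definition step :: "nat \<Rightarrow> int \<Rightarrow> int \<Rightarrow> edge" where
  "step x y y' = (pt x y, pt (x + 1) y')"

lemma pt_eq_iff: "pt x y = pt x' y' \<longleftrightarrow> x mod period = x' mod period \<and> y = y'"
  by (simp add: pt_def)

lemma step_eq_iff:
  "step x y z = step x' y' z' \<longleftrightarrow> x mod period = x' mod period \<and> y = y' \<and> z = z'"
  unfolding step_def pt_eq_iff prod.inject by (metis mod_add_cong)

lemma pt_add_period: "pt (x + period * k) y = pt x y"
  by (simp add: pt_def)

lemma step_add_period: "step (x + period * k) y z = step x y z"
  by (simp add: step_eq_iff)

lemma up_nbr_pt: "up_nbr a b (pt x y) = pt (x + 1) (y + int a)"
  by (simp add: up_nbr_def pt_def mod_simps)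

lemma down_nbr_pt: "down_nbr a b (pt x y) = pt (x + 1) (y - int b)"
  by (simp add: down_nbr_def pt_def mod_simps)

definition outflow :: "(edge \<Rightarrow> nat) \<Rightarrow> nat \<Rightarrow> int \<Rightarrow> nat" where
  "outflow w x y = w (step x y (y + int a)) + w (step x y (y - int b))"

text \<open>\<open>inflow w x y\<close> is the weight entering \<open>pt (x + 1) y\<close>, not \<open>pt x y\<close>.\<close>

definition inflow :: "(edge \<Rightarrow> nat) \<Rightarrow> nat \<Rightarrow> int \<Rightarrow> nat" where
  "inflow w x y = w (step x (y - int a) y) + w (step x (y + int b) y)"

text \<open>Finitely supported balanced weight functions on all of \<open>G_graph a b\<close>. The
  height bound of \<open>H_graph\<close> is left out, so that the same notion serves below any
  lap.\<close>

definition circulation :: "(edge \<Rightarrow> nat) \<Rightarrow> bool" where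
  "circulation w \<longleftrightarrow>
     (\<forall>e. w e > 0 \<longrightarrow> (\<exists>x y z. int period dvd y - int a * int x \<and>
        (z = y + int a \<or> z = y - int b) \<and> e = step x y z)) \<and>
     finite {e. w e > 0} \<and>
     (\<forall>x y. inflow w x y = outflow w (x + 1) y)"

text \<open>Lap cycles of \<open>G_graph\<close>, unrolled: periodicity says that the lap closes up,
  and divisibility at column 0 fixes the residues in all other columns.\<close>

definition lap_fun :: "(nat \<Rightarrow> int) \<Rightarrow> bool" where
  "lap_fun P \<longleftrightarrow> int period dvd P 0 \<and> (\<forall>x. P (x + period) = P x) \<and>
     (\<forall>x. P (x + 1) = P x + int a \<or> P (x + 1) = P x - int b)"

lemma lap_fun_step:
  assumes "lap_fun P"
  shows "P (x + 1) = P x + int a \<or> P (x + 1) = P x - int b"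
  using assms by (simp add: lap_fun_def)

lemma lap_fun_periodic:
  assumes "lap_fun P"
  shows "P (x + period * k) = P x"
proof (induction k)
  case (Suc k)
  have "P (x + period * Suc k) = P ((x + period * k) + period)" by (simp add: algebra_simps)
  then show ?case using Suc assms by (simp only: lap_fun_def)
qed simp

lemma lap_fun_mod:
  assumes "lap_fun P"
  shows "P (x mod period) = P x"
  using lap_fun_periodic[OF assms, of "x mod period" "x div period"] by simp

text \<open>An up-step leaves \<open>P x - a x\<close> unchanged and a down-step lowers it by the
  period.\<close>

lemma lap_fun_dvd:
  assumes "lap_fun P"
  shows "int period dvd P x - int a * int x"
proof (induction x)
  case 0
  then show ?case using assms by (simp add: lap_fun_def)
next
  case (Suc x)
  from lap_fun_step[OF assms, of x] show ?case
  proof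
    assume "P (x + 1) = P x + int a"
    then show ?thesis using Suc by (simp add: algebra_simps)
  next
    assume "P (x + 1) = P x - int b"
    then have "P (Suc x) - int a * int (Suc x) = (P x - int a * int x) - int period"
      by (simp add: algebra_simps)
    then show ?thesis using Suc by (metis dvd_diff dvd_refl)
  qed
qed

lemma circulationD:
  assumes "circulation w"
  shows "w e > 0 \<Longrightarrow> \<exists>x y z. int period dvd y - int a * int x \<and>
        (z = y + int a \<or> z = y - int b) \<and> e = step x y z"
    and "finite {e. w e > 0}"
    and "inflow w x y = outflow w (x + 1) y"
  using assms unfolding circulation_def by blast+

text \<open>An edge determines its column index only modulo the period, so the congruence has to be
  carried over to any chosen representative.\<close>

lemma dvd_shift_column:
  assumes "x mod period = x' mod period"
  shows "int period dvd y - int a * int x \<longleftrightarrow> int period dvd y - int a * int x'"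
proof -
  have "[int x = int x'] (mod int period)"
    using assms by (metis cong_def cong_int_iff)
  then have "int period dvd int a * int x - int a * int x'"
    by (metis cong_iff_dvd_diff cong_scalar_left)
  moreover have "y - int a * int x' = (y - int a * int x) + (int a * int x - int a * int x')" by simp
  ultimately show ?thesis by (metis dvd_add_left_iff)
qed

lemma circulation_step:
  assumes "circulation w" and "w (step x y z) > 0"
  shows "int period dvd y - int a * int x" and "z = y + int a \<or> z = y - int b"
  using circulationD(1)[OF assms] dvd_shift_column unfolding step_eq_iff by metis+

lemma outflow_dvd:
  assumes "circulation w" and "outflow w x y > 0"
  shows "int period dvd y - int a * int x"
  using circulation_step(1)[OF assms(1)] assms(2) unfolding outflow_def by force

lemma outflow_add_period: "outflow w (x + period * k) y = outflow w x y"
  by (simp only: outflow_def step_add_period)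

lemma outflow_tail:
  assumes "circulation w" and "w (step x y z) > 0"
  shows "outflow w x y > 0"
  using circulation_step(2)[OF assms] assms(2) by (auto simp: outflow_def)

lemma outflow_head:
  assumes "circulation w" and "w (step x y z) > 0"
  shows "outflow w (x + 1) z > 0"
proof -
  have "inflow w x z > 0"
    using circulation_step(2)[OF assms] assms(2) by (auto simp: inflow_def)
  then show ?thesis using circulationD(3)[OF assms(1)] by simp
qed

lemma outflow_edge:
  assumes "outflow w x y > 0"
  shows "\<exists>z. w (step x y z) > 0 \<and> (z = y + int a \<or> z = y - int b)"
  using assms by (auto simp: outflow_def)

text \<open>Let \<open>P x\<close> be the greatest supported height in column \<open>x\<close>. Some
  weighted edge leaves \<open>P x\<close> and some weighted edge enters \<open>P (x + 1)\<close>;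
  either the entering edge starts at \<open>P x\<close> or the leaving edge ends at
  \<open>P (x + 1)\<close>, because heights in a column differ by multiples of the period.\<close>

lemma crest_exists:
  assumes w: "circulation w" and pos: "w e > 0"
  obtains P where "lap_fun P" and "\<And>x. w (step x (P x) (P (x + 1))) > 0"
    and "\<And>x y. outflow w x y > 0 \<Longrightarrow> y \<le> P x"
proof -
  define Y where "Y x = {y. outflow w x y > 0}" for x
  define P where "P x = Max (Y x)" for x
  have fin: "finite (Y x)" for x
  proof (rule finite_subset)
    show "Y x \<subseteq> (\<lambda>e. snd (fst e)) ` {e. w e > 0}"
    proof
      fix y assume "y \<in> Y x"
      then obtain z where "w (step x y z) > 0" using outflow_edge[of w x y] unfolding Y_def by blast
      then show "y \<in> (\<lambda>e. snd (fst e)) ` {e. w e > 0}"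
        by (intro image_eqI[of _ _ "step x y z"]) (simp_all add: step_def pt_def)
    qed
    show "finite ((\<lambda>e. snd (fst e)) ` {e. w e > 0})"
      using circulationD(2)[OF w] by simp
  qed
  obtain x0 y0 z0 where "e = step x0 y0 z0" using circulationD(1)[OF w pos] by blast
  then have "Y x0 \<noteq> {}" using outflow_tail[OF w] pos by (auto simp: Y_def)
  moreover have "Y (x + 1) \<noteq> {}" if "Y x \<noteq> {}" for x
  proof -
    from that obtain y where "outflow w x y > 0" by (auto simp: Y_def)
    then obtain z where "w (step x y z) > 0" using outflow_edge by blast
    then show ?thesis using outflow_head[OF w] unfolding Y_def by blast
  qed
  ultimately have later: "Y (x0 + k) \<noteq> {}" for k
  proof (induction k)
    case (Suc k)
    then have "Y ((x0 + k) + 1) \<noteq> {}" by blast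
    then show ?case by simp
  qed simp
  have ne: "Y x \<noteq> {}" for x
  proof -
    \<comment> \<open>Column \<open>x\<close> may precede \<open>x0\<close>; adding enough periods
      moves it to \<open>x0\<close> or beyond without changing \<open>Y\<close>.\<close>
    have "1 * x0 \<le> period * x0" using a_pos by (intro mult_right_mono) auto
    then have "x0 \<le> x + period * x0" by linarith
    then obtain k where "x + period * x0 = x0 + k" using le_Suc_ex by blast
    then have "Y (x + period * x0) \<noteq> {}" using later[of k] by simp
    then show ?thesis by (simp add: Y_def outflow_add_period)
  qed
  have le: "y \<le> P x" if "outflow w x y > 0" for x y
    using that fin by (simp add: P_def Y_def)
  have on: "outflow w x (P x) > 0" for x
    using Max_in[OF fin ne, of x] by (simp add: P_def Y_def)
  have dvd: "int period dvd P x - int a * int x" for x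
    using outflow_dvd[OF w on] .
  have stp: "(P (x + 1) = P x + int a \<or> P (x + 1) = P x - int b) \<and>
      w (step x (P x) (P (x + 1))) > 0" for x
  proof -
    obtain z where z: "w (step x (P x) z) > 0" "z = P x + int a \<or> z = P x - int b"
      using outflow_edge[OF on] by blast
    have zle: "z \<le> P (x + 1)" using le[OF outflow_head[OF w z(1)]] .
    have "inflow w x (P (x + 1)) > 0" using on[of "x + 1"] circulationD(3)[OF w] by simp
    then consider "w (step x (P (x + 1) - int a) (P (x + 1))) > 0"
      | "w (step x (P (x + 1) + int b) (P (x + 1))) > 0" by (auto simp: inflow_def)
    then show ?thesis
    proof cases
      case 1
      then have "P (x + 1) - int a \<le> P x" using le outflow_tail[OF w] by blast
      show ?thesis
      proof (cases "P (x + 1) - int a = P x")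
        case True
        then show ?thesis using 1 by auto
      next
        case False
        have "P x - (P (x + 1) - int a) = (P x - int a * int x) - (P (x + 1) - int a * int (x + 1))"
          by (simp add: algebra_simps)
        then have "int period dvd P x - (P (x + 1) - int a)"
          using dvd_diff[OF dvd[of x] dvd[of "x + 1"]] by (simp only:)
        \<comment> \<open>An up-edge that starts below the top does so by at least a full period;
          then even the down-edge from \<open>P x\<close> ends no lower than
          \<open>P (x + 1)\<close>.\<close>
        then have "P (x + 1) - int a + int period \<le> P x"
          using False \<open>P (x + 1) - int a \<le> P x\<close> a_pos by (intro dvd_between) auto
        then have "z = P (x + 1)" using zle z(2) by auto
        then show ?thesis using z by simp
      qed
    next
      case 2
      then have "P (x + 1) + int b \<le> P x" using le outflow_tail[OF w] by blast
      then have "z = P (x + 1)" using zle z(2) by auto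
      then show ?thesis using z by simp
    qed
  qed
  have "P (x + period) = P x" for x
    using outflow_add_period[of w x 1] by (simp add: P_def Y_def)
  then have "lap_fun P" using stp dvd[of 0] by (auto simp: lap_fun_def)
  then show thesis using that stp le by blast
qed

section \<open>Laps as circulations of weight one, and their removal\<close>

definition lap_edges :: "(nat \<Rightarrow> int) \<Rightarrow> edge set" where
  "lap_edges P = range (\<lambda>x. step x (P x) (P (x + 1)))"

text \<open>A lap has one vertex per column, and its periodicity absorbs the ambiguity of the column
  index in \<open>step\<close>.\<close>

lemma step_in_lap_edges:
  assumes "lap_fun P"
  shows "step x y z \<in> lap_edges P \<longleftrightarrow> y = P x \<and> z = P (x + 1)"
proof
  assume "step x y z \<in> lap_edges P"
  then obtain x' where x': "x mod period = x' mod period" "y = P x'" "z = P (x' + 1)"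
    by (auto simp: lap_edges_def step_eq_iff)
  then have "(x + 1) mod period = (x' + 1) mod period" by (metis mod_add_cong)
  then show "y = P x \<and> z = P (x + 1)"
    using x' lap_fun_mod[OF assms, of x] lap_fun_mod[OF assms, of x']
      lap_fun_mod[OF assms, of "x + 1"] lap_fun_mod[OF assms, of "x' + 1"] by simp
qed (auto simp: lap_edges_def)

lemma lap_edges_eq_image:
  assumes "lap_fun P"
  shows "lap_edges P = (\<lambda>x. step x (P x) (P (x + 1))) ` {..<period}"
proof -
  have "step x (P x) (P (x + 1)) \<in> (\<lambda>x. step x (P x) (P (x + 1))) ` {..<period}" for x
  proof (rule image_eqI)
    have "(x mod period + 1) mod period = (x + 1) mod period" by (simp add: mod_simps)
    then have "P (x mod period + 1) = P (x + 1)"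
      using lap_fun_mod[OF assms, of "x mod period + 1"] lap_fun_mod[OF assms, of "x + 1"] by simp
    then show "step x (P x) (P (x + 1)) = step (x mod period) (P (x mod period)) (P (x mod period + 1))"
      by (simp add: step_eq_iff lap_fun_mod[OF assms])
    show "x mod period \<in> {..<period}" using a_pos by simp
  qed
  then show ?thesis by (auto simp: lap_edges_def)
qed

lemma finite_lap_edges: "lap_fun P \<Longrightarrow> finite (lap_edges P)"
  by (simp add: lap_edges_eq_image)

lemma card_lap_edges:
  assumes "lap_fun P"
  shows "card (lap_edges P) = period"
proof -
  have "inj_on (\<lambda>x. step x (P x) (P (x + 1))) {..<period}"
    by (auto simp: inj_on_def step_eq_iff)
  then show ?thesis by (simp add: lap_edges_eq_image[OF assms] card_image)
qed

definition lap_weight :: "(nat \<Rightarrow> int) \<Rightarrow> edge \<Rightarrow> nat" where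
  "lap_weight P e = of_bool (e \<in> lap_edges P)"

lemma outflow_lap_weight:
  assumes "lap_fun P"
  shows "outflow (lap_weight P) x y = of_bool (y = P x)"
  using lap_fun_step[OF assms, of x] a_pos
  by (auto simp: outflow_def lap_weight_def step_in_lap_edges[OF assms])

lemma inflow_lap_weight:
  assumes "lap_fun P"
  shows "inflow (lap_weight P) x y = of_bool (y = P (x + 1))"
  using lap_fun_step[OF assms, of x] a_pos
  by (auto simp: inflow_def lap_weight_def step_in_lap_edges[OF assms])

lemma outflow_add: "outflow (\<lambda>e. w e + w' e) x y = outflow w x y + outflow w' x y"
  by (simp add: outflow_def)

lemma inflow_add: "inflow (\<lambda>e. w e + w' e) x y = inflow w x y + inflow w' x y"
  by (simp add: inflow_def)

lemma circulation_lap_weight: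
  assumes "lap_fun P"
  shows "circulation (lap_weight P)"
proof -
  have "\<exists>x y z. int period dvd y - int a * int x \<and> (z = y + int a \<or> z = y - int b) \<and> e = step x y z"
    if pos: "lap_weight P e > 0" for e
  proof -
    obtain x where "e = step x (P x) (P (x + 1))"
      using pos by (auto simp: lap_weight_def lap_edges_def)
    then show ?thesis using lap_fun_dvd[OF assms, of x] lap_fun_step[OF assms, of x] by blast
  qed
  moreover have "finite {e. lap_weight P e > 0}"
    using finite_lap_edges[OF assms] by (simp add: lap_weight_def)
  ultimately show ?thesis
    by (simp add: circulation_def outflow_lap_weight[OF assms] inflow_lap_weight[OF assms])
qed

lemma circulation_add:
  assumes "circulation w" and "circulation w'"
  shows "circulation (\<lambda>e. w e + w' e)"
proof -
  have "finite {e. w e + w' e > 0}"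
    using circulationD(2)[OF assms(1)] circulationD(2)[OF assms(2)]
    by (simp add: Collect_disj_eq)
  then show ?thesis using assms
    by (auto simp: circulation_def outflow_add inflow_add)
qed

text \<open>The bound \<open>le\<close> makes the truncated subtraction exact, so \<open>w'\<close>
  cancels from the conservation law of \<open>w\<close>.\<close>

lemma circulation_diff:
  assumes "circulation w" and "circulation w'" and le: "\<And>e. w' e \<le> w e"
  shows "circulation (\<lambda>e. w e - w' e)"
proof -
  have fin: "finite {e. w e - w' e > 0}"
    by (rule finite_subset[OF _ circulationD(2)[OF assms(1)]]) auto
  have "inflow (\<lambda>e. w e - w' e) x y = outflow (\<lambda>e. w e - w' e) (x + 1) y" for x y
  proof -
    have "inflow w x y = inflow (\<lambda>e. w e - w' e) x y + inflow w' x y"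
      using inflow_add[of "\<lambda>e. w e - w' e" w' x y] le by simp
    moreover have "outflow w (x + 1) y
        = outflow (\<lambda>e. w e - w' e) (x + 1) y + outflow w' (x + 1) y"
      using outflow_add[of "\<lambda>e. w e - w' e" w' "x + 1" y] le by simp
    ultimately show ?thesis
      using circulationD(3)[OF assms(1), of x y] circulationD(3)[OF assms(2), of x y] by simp
  qed
  moreover have "\<exists>x y z. int period dvd y - int a * int x \<and> (z = y + int a \<or> z = y - int b) \<and> e = step x y z"
    if "w e - w' e > 0" for e
    using that circulationD(1)[OF assms(1), of e] by simp
  ultimately show ?thesis using fin by (simp add: circulation_def)
qed

definition total :: "(edge \<Rightarrow> nat) \<Rightarrow> nat" where
  "total w = (\<Sum>e | w e > 0. w e)"

lemma total_superset:
  assumes "finite A" and "{e. w e > 0} \<subseteq> A"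
  shows "total w = sum w A"
  unfolding total_def using assms by (intro sum.mono_neutral_left) auto

lemma total_add_lap_weight:
  assumes "circulation w" and "lap_fun P"
  shows "total (\<lambda>e. w e + lap_weight P e) = total w + period"
proof -
  let ?A = "{e. w e > 0} \<union> lap_edges P"
  have fin: "finite ?A" using circulationD(2)[OF assms(1)] finite_lap_edges[OF assms(2)] by simp
  have "total (\<lambda>e. w e + lap_weight P e) = (\<Sum>e\<in>?A. w e + lap_weight P e)"
    by (rule total_superset[OF fin]) (auto simp: lap_weight_def)
  also have "\<dots> = sum w ?A + sum (lap_weight P) ?A" by (rule sum.distrib)
  also have "sum w ?A = total w" by (rule total_superset[OF fin, symmetric]) auto
  also have "sum (lap_weight P) ?A = card (?A \<inter> lap_edges P)"
    using fin by (simp add: lap_weight_def of_bool_def sum.If_cases)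
  also have "?A \<inter> lap_edges P = lap_edges P" by auto
  finally show ?thesis by (simp add: card_lap_edges[OF assms(2)])
qed

text \<open>A lap uses each of its edges once, so positive weight on them suffices for subtracting
  it. The drop of the total is the measure in \<open>edge_on_lap\<close> and the passage from
  \<open>Suc n\<close> to \<open>n\<close> in \<open>hanging_peel\<close>.\<close>

lemma peel_lap:
  assumes "circulation w" and "lap_fun P" and pos: "\<And>x. w (step x (P x) (P (x + 1))) > 0"
  obtains w' where "circulation w'" and "w = (\<lambda>e. w' e + lap_weight P e)"
    and "total w = total w' + period"
proof -
  let ?w' = "\<lambda>e. w e - lap_weight P e"
  have le: "lap_weight P e \<le> w e" for e
    using pos by (fastforce simp: lap_weight_def lap_edges_def of_bool_def Suc_le_eq)
  have c: "circulation ?w'" using circulation_diff[OF assms(1) circulation_lap_weight le] assms(2) by simp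
  have eq: "w = (\<lambda>e. ?w' e + lap_weight P e)" using le by auto
  show thesis using that[OF c eq] total_add_lap_weight[OF c assms(2)] eq by simp
qed

text \<open>Crests are peeled off until one of them contains \<open>e\<close>. The total decreases
  each time, and a lap in the support of a remainder lies in the support of
  \<open>w\<close>.\<close>

lemma edge_on_lap:
  assumes "circulation w" and "w e > 0"
  obtains P where "lap_fun P" and "\<And>x. w (step x (P x) (P (x + 1))) > 0" and "e \<in> lap_edges P"
proof -
  have "\<exists>P. lap_fun P \<and> (\<forall>x. w (step x (P x) (P (x + 1))) > 0) \<and> e \<in> lap_edges P"
    using assms
  proof (induction "total w" arbitrary: w rule: less_induct)
    case less
    obtain P where P: "lap_fun P" "\<And>x. w (step x (P x) (P (x + 1))) > 0"
      using crest_exists[OF less.prems] by metis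
    obtain w' where w': "circulation w'" "w = (\<lambda>e. w' e + lap_weight P e)"
        "total w = total w' + period"
      using peel_lap[OF less.prems(1) P] by blast
    show ?case
    proof (cases "e \<in> lap_edges P")
      case True
      then show ?thesis using P by blast
    next
      case False
      then have "w' e > 0" using less.prems(2) w'(2) by (simp add: lap_weight_def)
      moreover have "total w' < total w" using w'(3) a_pos by simp
      ultimately obtain Q where "lap_fun Q" "\<forall>x. w' (step x (Q x) (Q (x + 1))) > 0" "e \<in> lap_edges Q"
        using less.hyps w'(1) by blast
      then show ?thesis using w'(2) by auto
    qed
  qed
  then show thesis using that by blast
qed

section \<open>Stacks of touching laps\<close>

text \<open>The highest vertical translate of \<open>P\<close> that stays at or below
  \<open>C\<close>. For laps the range is finite by periodicity, so \<open>Min\<close> is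
  meaningful.\<close>

definition slide :: "(nat \<Rightarrow> int) \<Rightarrow> (nat \<Rightarrow> int) \<Rightarrow> nat \<Rightarrow> int" where
  "slide C P x = P x + Min (range (\<lambda>x. C x - P x))"

lemma finite_range_lap_diff:
  assumes "lap_fun C" and "lap_fun P"
  shows "finite (range (\<lambda>x. C x - P x))"
proof (rule finite_subset)
  show "range (\<lambda>x. C x - P x) \<subseteq> (\<lambda>x. C x - P x) ` {..<period}"
  proof
    fix d assume "d \<in> range (\<lambda>x. C x - P x)"
    then obtain x where "d = C (x mod period) - P (x mod period)"
      using lap_fun_mod[OF assms(1)] lap_fun_mod[OF assms(2)] by auto
    then show "d \<in> (\<lambda>x. C x - P x) ` {..<period}" using a_pos by auto
  qed
qed simp

lemma slide_le:
  assumes "lap_fun C" and "lap_fun P"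
  shows "slide C P x \<le> C x"
  using Min_le[OF finite_range_lap_diff[OF assms], of "C x - P x"] by (simp add: slide_def)

lemma slide_touches:
  assumes "lap_fun C" and "lap_fun P"
  shows "\<exists>x. slide C P x = C x"
proof -
  obtain x where "Min (range (\<lambda>x. C x - P x)) = C x - P x"
    using Min_in[OF finite_range_lap_diff[OF assms]] by blast
  then have "slide C P x = C x" by (simp add: slide_def)
  then show ?thesis by blast
qed

lemma lap_fun_translate:
  assumes "lap_fun P" and "int period dvd c"
  shows "lap_fun (\<lambda>x. P x + c)"
  using assms by (auto simp: lap_fun_def)

text \<open>The minimum is attained at some column, where it is a difference of two heights with the
  same residue, hence a multiple of the period.\<close>

lemma lap_fun_slide:
  assumes "lap_fun C" and "lap_fun P"
  shows "lap_fun (slide C P)"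
proof -
  obtain x where "Min (range (\<lambda>x. C x - P x)) = C x - P x"
    using Min_in[OF finite_range_lap_diff[OF assms]] by blast
  moreover have "int period dvd (C x - int a * int x) - (P x - int a * int x)"
    using dvd_diff[OF lap_fun_dvd[OF assms(1)] lap_fun_dvd[OF assms(2)]] .
  ultimately have "int period dvd Min (range (\<lambda>x. C x - P x))" by simp
  then show ?thesis using lap_fun_translate[OF assms(2)] by (simp add: slide_def[abs_def])
qed

text \<open>At column 0 both slid laps show just their shifts, so the shifts agree and
  cancel.\<close>

lemma slide_inj:
  assumes "P 0 = 0" and "Q 0 = 0" and "slide C P = slide C Q"
  shows "P = Q"
proof
  fix x
  have "P x + Min (range (\<lambda>x. C x - P x)) = Q x + Min (range (\<lambda>x. C x - Q x))"
    and "P 0 + Min (range (\<lambda>x. C x - P x)) = Q 0 + Min (range (\<lambda>x. C x - Q x))"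
    using fun_cong[OF assms(3), of x] fun_cong[OF assms(3), of 0] by (simp_all only: slide_def)
  then show "P x = Q x" using assms(1,2) by simp
qed

text \<open>Surjectivity of sliding: a lap touching \<open>C\<close> from below is recovered from
  its translate to the origin, the shift being \<open>D 0\<close>.\<close>

lemma slide_eq_self:
  assumes "lap_fun C" and "lap_fun D" and "\<And>x. D x \<le> C x" and "D x0 = C x0"
  shows "slide C (\<lambda>x. D x - D 0) = D"
proof -
  have "int period dvd - D 0" using assms(2) by (simp add: lap_fun_def)
  then have "lap_fun (\<lambda>x. D x - D 0)" using lap_fun_translate[OF assms(2)] by fastforce
  then have "Min (range (\<lambda>x. C x - (D x - D 0))) = D 0"
    using assms(3,4) finite_range_lap_diff[OF assms(1), of "\<lambda>x. D x - D 0"]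
    by (intro Min_eqI) (auto simp: image_iff intro!: exI[of _ x0])
  then show ?thesis by (auto simp: slide_def)
qed

text \<open>Edges only lead forward, so an earlier column is reached by going around the
  lap.\<close>

lemma reach_along_lap:
  assumes "lap_fun P" and pos: "\<And>x. w (step x (P x) (P (x + 1))) > 0"
  shows "(pt x (P x), pt x' (P x')) \<in> {e. w e > 0}\<^sup>*"
proof -
  have fwd: "(pt x (P x), pt (x + k) (P (x + k))) \<in> {e. w e > 0}\<^sup>*" for k
  proof (induction k)
    case (Suc k)
    have "(pt (x + k) (P (x + k)), pt (x + Suc k) (P (x + Suc k))) \<in> {e. w e > 0}"
      using pos[of "x + k"] by (simp add: step_def)
    then show ?case using Suc by (rule rtrancl_into_rtrancl[rotated])
  qed simp
  have "1 * x \<le> period * x" using a_pos by (intro mult_right_mono) auto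
  then have "x \<le> x' + period * x" by linarith
  then obtain k where "x' + period * x = x + k" using le_Suc_ex by blast
  then show ?thesis using fwd[of k] lap_fun_periodic[OF assms(1)] pt_add_period by metis
qed

lemma outflow_pt_cong:
  assumes "pt x y = pt x' y'"
  shows "outflow w x y = outflow w x' y'"
proof -
  have "step x y u = step x' y' u" for u using assms by (simp add: step_eq_iff pt_eq_iff)
  then show ?thesis using assms by (simp add: outflow_def pt_eq_iff)
qed

lemma circulation_edge:
  assumes "circulation w" and "w (pt x y, q) > 0"
  obtains z where "(pt x y, q) = step x y z" and "z = y + int a \<or> z = y - int b"
proof -
  obtain x' y' z where s: "(pt x y, q) = step x' y' z" "z = y' + int a \<or> z = y' - int b"
    using circulationD(1)[OF assms] by blast
  then have p: "pt x y = pt x' y'" by (simp add: step_def)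
  then have "step x' y' z = step x y z" by (simp add: step_eq_iff pt_eq_iff)
  then show thesis using that s p by (simp add: pt_eq_iff)
qed

text \<open>A nontrivial path leaves its source by a weighted edge. This puts the start of a
  connecting path into the support, and thereby at or below the crest.\<close>

lemma outflow_reach_source:
  assumes "circulation w" and "(pt x y, pt x' y') \<in> {e. w e > 0}\<^sup>*" and "outflow w x' y' > 0"
  shows "outflow w x y > 0"
  using assms(2)
proof (cases rule: converse_rtranclE)
  case base
  then show ?thesis using assms(3) outflow_pt_cong by metis
next
  case (step q)
  then have pos: "w (pt x y, q) > 0" by simp
  then obtain z where "(pt x y, q) = slopes.step a b x y z"
    by (rule circulation_edge[OF assms(1)])
  then show ?thesis using outflow_tail[OF assms(1)] pos by simp
qed

text \<open>Generalises the balanced origin-connected weight functions to an arbitrary lap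
  \<open>C\<close> as ceiling, with connection from anywhere on \<open>C\<close> in place of the
  origin. In this form the condition is inherited when the crest is removed and becomes the new
  ceiling.\<close>

definition hanging :: "nat \<Rightarrow> (nat \<Rightarrow> int) \<Rightarrow> (edge \<Rightarrow> nat) set" where
  "hanging n C = {w. circulation w \<and> total w = period * n \<and>
     (\<forall>x y. outflow w x y > 0 \<longrightarrow> y \<le> C x) \<and>
     (\<forall>x y. outflow w x y > 0 \<longrightarrow> (\<exists>x'. (pt x' (C x'), pt x y) \<in> {e. w e > 0}\<^sup>*))}"

lemma hangingD:
  assumes "w \<in> hanging n C"
  shows "circulation w" and "total w = period * n"
    and "outflow w x y > 0 \<Longrightarrow> y \<le> C x"
    and "outflow w x y > 0 \<Longrightarrow> \<exists>x'. (pt x' (C x'), pt x y) \<in> {e. w e > 0}\<^sup>*"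
  using assms unfolding hanging_def by blast+

lemma total_eq_0_iff:
  assumes "circulation w"
  shows "total w = 0 \<longleftrightarrow> w = (\<lambda>_. 0)"
proof
  assume "total w = 0"
  then have "\<forall>e\<in>{e. w e > 0}. w e = 0"
    using circulationD(2)[OF assms] by (simp add: total_def)
  then show "w = (\<lambda>_. 0)" by force
qed (simp add: total_def)

lemma hanging_0: "hanging 0 C = {\<lambda>_. 0}"
proof
  show "hanging 0 C \<subseteq> {\<lambda>_. 0}"
    using hangingD(1,2)[of _ 0] total_eq_0_iff by fastforce
  show "{\<lambda>_. 0} \<subseteq> hanging 0 C"
    by (simp add: hanging_def circulation_def total_def outflow_def inflow_def)
qed

text \<open>From the contact point one runs along \<open>D\<close> to the place where the relevant
  part of \<open>w\<close> is attached.\<close>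

lemma hanging_add_lap:
  assumes "lap_fun C" and "lap_fun D" and le: "\<And>x. D x \<le> C x" and touch: "D x0 = C x0"
    and w: "w \<in> hanging n D"
  shows "(\<lambda>e. w e + lap_weight D e) \<in> hanging (Suc n) C"
proof -
  let ?v = "\<lambda>e. w e + lap_weight D e"
  have out: "outflow w x y > 0 \<or> y = D x" if "outflow ?v x y > 0" for x y
    using that by (auto simp: outflow_add outflow_lap_weight[OF assms(2)] split: if_splits)
  have posD: "?v (step x (D x) (D (x + 1))) > 0" for x
    using step_in_lap_edges[OF assms(2)] by (simp add: lap_weight_def)
  have "y \<le> C x" if "outflow ?v x y > 0" for x y
    using out[OF that] hangingD(3)[OF w, of x y] le[of x] by auto
  moreover have "\<exists>x'. (pt x' (C x'), pt x y) \<in> {e. ?v e > 0}\<^sup>*" if pos: "outflow ?v x y > 0" for x y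
  proof -
    have fromD: "(pt x0 (C x0), pt x' (D x')) \<in> {e. ?v e > 0}\<^sup>*" for x'
      using reach_along_lap[OF assms(2), of ?v x0 x'] posD touch by simp
    show ?thesis
    proof (cases "y = D x")
      case True
      then show ?thesis using fromD by blast
    next
      case False
      then obtain x' where "(pt x' (D x'), pt x y) \<in> {e. w e > 0}\<^sup>*"
        using out[OF pos] hangingD(4)[OF w] by blast
      moreover have "{e. w e > 0}\<^sup>* \<subseteq> {e. ?v e > 0}\<^sup>*" by (intro rtrancl_mono) auto
      ultimately show ?thesis using fromD by (meson rtrancl_trans subsetD)
    qed
  qed
  ultimately show ?thesis
    using circulation_add[OF hangingD(1)[OF w] circulation_lap_weight[OF assms(2)]]
      total_add_lap_weight[OF hangingD(1)[OF w] assms(2)] hangingD(2)[OF w]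
    by (simp add: hanging_def)
qed

text \<open>Here \<open>D\<close> is the crest. It touches \<open>C\<close> because a path from
  \<open>C\<close> to a vertex of \<open>D\<close> starts in the support, thus at or below
  \<open>D\<close>.\<close>

lemma hanging_peel:
  assumes "lap_fun C" and w: "w \<in> hanging (Suc n) C"
  obtains D w' x0 where "lap_fun D" and "\<And>x. D x \<le> C x" and "D x0 = C x0"
    and "w' \<in> hanging n D" and "w = (\<lambda>e. w' e + lap_weight D e)"
proof -
  have "total w > 0" using hangingD(2)[OF w] a_pos by simp
  then have "w \<noteq> (\<lambda>_. 0)" using total_eq_0_iff[OF hangingD(1)[OF w]] by simp
  then obtain e where "w e > 0" by fastforce
  then obtain D where D: "lap_fun D" "\<And>x. w (step x (D x) (D (x + 1))) > 0"
      "\<And>x y. outflow w x y > 0 \<Longrightarrow> y \<le> D x"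
    using crest_exists[OF hangingD(1)[OF w]] by metis
  obtain w' where w': "circulation w'" "w = (\<lambda>e. w' e + lap_weight D e)"
      "total w = total w' + period"
    using peel_lap[OF hangingD(1)[OF w] D(1,2)] by blast
  have onD: "outflow w x (D x) > 0" for x using outflow_tail[OF hangingD(1)[OF w] D(2)] .
  have le: "D x \<le> C x" for x using hangingD(3)[OF w onD] .
  obtain x0 where "(pt x0 (C x0), pt 0 (D 0)) \<in> {e. w e > 0}\<^sup>*"
    using hangingD(4)[OF w onD] by blast
  then have "C x0 \<le> D x0" using outflow_reach_source[OF hangingD(1)[OF w]] onD D(3) by blast
  then have touch: "D x0 = C x0" using le[of x0] by simp
  \<comment> \<open>Whenever the path uses an edge of \<open>D\<close> it is back on
    \<open>D\<close>, and a new start is chosen there; all other edges keep their weight. In effect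
    the path is cut after its last edge on \<open>D\<close>.\<close>
  have reach: "\<exists>x'. (pt x' (D x'), q) \<in> {e. w' e > 0}\<^sup>*"
    if "(p, q) \<in> {e. w e > 0}\<^sup>*" and "p = pt x1 (D x1)" for p q x1
    using that
  proof (induction rule: rtrancl_induct)
    case (step q r)
    show ?case
    proof (cases "(q, r) \<in> lap_edges D")
      case True
      then obtain x2 where "r = pt (x2 + 1) (D (x2 + 1))" by (auto simp: lap_edges_def step_def)
      then show ?thesis by blast
    next
      case False
      then have "w' (q, r) > 0" using step(2) w'(2) by (simp add: lap_weight_def)
      then show ?thesis using step(3,4) by (meson rtrancl_into_rtrancl mem_Collect_eq)
    qed
  qed blast
  have sub: "outflow w x y > 0" if "outflow w' x y > 0" for x y
    using that unfolding w'(2) by (simp add: outflow_add)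
  have "\<exists>x'. (pt x' (D x'), pt x y) \<in> {e. w' e > 0}\<^sup>*" if pos: "outflow w' x y > 0" for x y
  proof -
    obtain x1 where x1: "(pt x1 (C x1), pt x y) \<in> {e. w e > 0}\<^sup>*"
      using hangingD(4)[OF w sub[OF pos]] by blast
    then have "C x1 \<le> D x1"
      using outflow_reach_source[OF hangingD(1)[OF w]] sub[OF pos] D(3) by blast
    then have "C x1 = D x1" using le[of x1] by simp
    then show ?thesis using reach[OF x1] by simp
  qed
  then have "w' \<in> hanging n D"
    using w'(1,3) hangingD(2)[OF w] D(3) sub by (auto simp: hanging_def)
  then show thesis using that D(1) le touch w'(2) by blast
qed

text \<open>In both decompositions the removed lap is the crest of the sum: outflow at height
  \<open>D x\<close> must come, on the other side, from \<open>D'\<close> or from weight at or below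
  \<open>D'\<close>.\<close>

lemma hanging_peel_unique:
  assumes "lap_fun D" and "lap_fun D'" and "w \<in> hanging n D" and "w' \<in> hanging n' D'"
    and eq: "(\<lambda>e. w e + lap_weight D e) = (\<lambda>e. w' e + lap_weight D' e)"
  shows "D = D'" and "w = w'"
proof -
  have out: "outflow w x y + of_bool (y = D x) = outflow w' x y + of_bool (y = D' x)" for x y
    using arg_cong[OF eq, of "\<lambda>v. outflow v x y"]
    by (simp add: outflow_add outflow_lap_weight assms(1,2))
  have "D x = D' x" for x
  proof (rule antisym)
    show "D x \<le> D' x" using out[of x "D x"] hangingD(3)[OF assms(4), of x "D x"]
      by (cases "D x = D' x") auto
    show "D' x \<le> D x" using out[of x "D' x"] hangingD(3)[OF assms(3), of x "D' x"]
      by (cases "D x = D' x") auto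
  qed
  then show D: "D = D'" by blast
  show "w = w'" using fun_cong[OF eq] unfolding D by auto
qed

definition start_laps :: "(nat \<Rightarrow> int) set" where
  "start_laps = {P. lap_fun P \<and> P 0 = 0}"

text \<open>The inverse of repeated crest removal: each lap hangs from the one placed before it, so
  the head of the list becomes the crest.\<close>

fun stack :: "(nat \<Rightarrow> int) \<Rightarrow> (nat \<Rightarrow> int) list \<Rightarrow> edge \<Rightarrow> nat" where
  "stack C [] = (\<lambda>_. 0)"
| "stack C (P # Ps) = (\<lambda>e. stack (slide C P) Ps e + lap_weight (slide C P) e)"

lemma stack_hanging:
  assumes "lap_fun C" and "set Ps \<subseteq> start_laps"
  shows "stack C Ps \<in> hanging (length Ps) C"
  using assms
proof (induction Ps arbitrary: C)
  case (Cons P Ps)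
  then have P: "lap_fun P" by (simp add: start_laps_def)
  obtain x0 where "slide C P x0 = C x0" using slide_touches[OF Cons.prems(1) P] by blast
  then show ?case
    using hanging_add_lap[OF Cons.prems(1) lap_fun_slide slide_le _ Cons.IH] Cons.prems P lap_fun_slide
    by simp
qed (simp add: hanging_0)

text \<open>Induction with the ceiling generalised: crest removal determines the first slid lap and
  the remainder, while \<open>slide_inj\<close> and \<open>slide_eq_self\<close> pass between that
  lap and its translate to the origin.\<close>

lemma bij_betw_stack:
  assumes "lap_fun C"
  shows "bij_betw (stack C) {Ps. length Ps = n \<and> set Ps \<subseteq> start_laps} (hanging n C)"
proof -
  have inj: "Ps = Qs" if "lap_fun C" "length Ps = length Qs" "set Ps \<subseteq> start_laps" "set Qs \<subseteq> start_laps"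
      "stack C Ps = stack C Qs" for C Ps Qs
    using that(2,1,3-)
  proof (induction arbitrary: C rule: list_induct2)
    case (Cons P Ps Q Qs)
    then have PQ: "lap_fun P" "lap_fun Q" "P 0 = 0" "Q 0 = 0" by (auto simp: start_laps_def)
    have laps: "lap_fun (slide C P)" "lap_fun (slide C Q)" using lap_fun_slide Cons.prems(1) PQ by auto
    have h: "stack (slide C P) Ps \<in> hanging (length Ps) (slide C P)"
      "stack (slide C Q) Qs \<in> hanging (length Qs) (slide C Q)"
      using stack_hanging laps Cons.prems by auto
    note u = hanging_peel_unique[OF laps h Cons.prems(4)[unfolded stack.simps]]
    have "P = Q" using slide_inj[OF PQ(3,4) u(1)] .
    moreover have "Ps = Qs" using Cons.IH[OF laps(1)] Cons.prems u by simp
    ultimately show ?case by simp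
  qed simp
  have surj: "\<exists>Ps. length Ps = n \<and> set Ps \<subseteq> start_laps \<and> stack C Ps = w"
    if "lap_fun C" "w \<in> hanging n C" for C w
    using that
  proof (induction n arbitrary: C w)
    case 0
    then show ?case by (simp add: hanging_0)
  next
    case (Suc n)
    obtain D w' x0 where D: "lap_fun D" "\<And>x. D x \<le> C x" "D x0 = C x0"
        "w' \<in> hanging n D" "w = (\<lambda>e. w' e + lap_weight D e)"
      by (rule hanging_peel[OF Suc.prems]) (rule that)
    obtain Ps where Ps: "length Ps = n" "set Ps \<subseteq> start_laps" "stack D Ps = w'"
      using Suc.IH[OF D(1,4)] by blast
    have "int period dvd - D 0" using D(1) by (simp add: lap_fun_def)
    then have "(\<lambda>x. D x - D 0) \<in> start_laps"
      using lap_fun_translate[OF D(1)] by (fastforce simp: start_laps_def)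
    moreover have "slide C (\<lambda>x. D x - D 0) = D" using slide_eq_self[OF Suc.prems(1) D(1-3)] .
    ultimately show ?case using Ps D(5)
      by (intro exI[of _ "(\<lambda>x. D x - D 0) # Ps"]) simp
  qed
  show ?thesis
    unfolding bij_betw_def
  proof
    show "inj_on (stack C) {Ps. length Ps = n \<and> set Ps \<subseteq> start_laps}"
      using inj[OF assms] by (auto simp: inj_on_def)
    show "stack C ` {Ps. length Ps = n \<and> set Ps \<subseteq> start_laps} = hanging n C"
      using surj[OF assms] stack_hanging[OF assms] by blast
  qed
qed

section \<open>Weight functions on the graph\<close>

definition roof :: "nat \<Rightarrow> int" where
  "roof x = height a b (x mod period)"

text \<open>The line rising from the origin with slope \<open>a\<close> and the line falling to 0 at
  \<open>period\<close> with slope \<open>-b\<close> cross at \<open>x = b\<close>.\<close>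

lemma height_eq_min:
  assumes "x \<le> period"
  shows "height a b x = min (int a * int x) (int b * (int period - int x))"
proof (cases "x \<le> b")
  case True
  then have "int period * int x \<le> int period * int b" by (intro mult_left_mono) auto
  then show ?thesis using True by (simp add: height_def algebra_simps min_def)
next
  case False
  then have "int period * int b \<le> int period * int x" by (intro mult_left_mono) auto
  then show ?thesis using False by (simp add: height_def algebra_simps min_def)
qed

lemma lap_fun_roof: "lap_fun roof"
proof -
  have step: "roof (x + 1) = roof x + int a \<or> roof (x + 1) = roof x - int b" for x
  proof (cases "x mod period + 1 = period")
    case True
    then have "(x + 1) mod period = 0" by (simp add: mod_Suc)
    then have 0: "roof (x + 1) = 0" by (simp add: roof_def height_def)
    have x: "x mod period = period - 1" using True by simp
    have "int (period - 1) = int period - 1" using a_pos by simp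
    then have "roof x = min (int a * (int period - 1)) (int b)"
      unfolding roof_def x by (subst height_eq_min) (auto simp: algebra_simps)
    \<comment> \<open>The second term of the minimum is the smaller one: the last column has height
      \<open>b\<close>, and a down-step closes the lap at 0.\<close>
    moreover have "1 * int b \<le> int a * (int period - 1)"
      using a_pos by (intro mult_mono) auto
    ultimately show ?thesis using 0 by simp
  next
    case False
    moreover have "x mod period < period" using a_pos by simp
    ultimately have "(x + 1) mod period = x mod period + 1" by (simp add: mod_Suc)
    then show ?thesis
      by (cases "x mod period < b"; cases "x mod period = b")
        (auto simp: roof_def height_def algebra_simps)
  qed
  show ?thesis
    unfolding lap_fun_def using step by (auto simp: roof_def height_def)
qed

lemma lap_fun_le_add:
  assumes "lap_fun P"
  shows "P (x + k) \<le> P x + int a * int k" and "P x - int b * int k \<le> P (x + k)"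
proof -
  have "P (x + k) \<le> P x + int a * int k \<and> P x - int b * int k \<le> P (x + k)"
  proof (induction k)
    case (Suc k)
    then show ?case using lap_fun_step[OF assms, of "x + k"] by (auto simp: algebra_simps)
  qed simp
  then show "P (x + k) \<le> P x + int a * int k" and "P x - int b * int k \<le> P (x + k)" by auto
qed

text \<open>From 0 a lap climbs by at most \<open>a\<close> per step, and on its way back to 0 it
  sinks by at most \<open>b\<close> per step; these are the two bounds in
  \<open>height_eq_min\<close>.\<close>

lemma start_lap_le_roof:
  assumes "P \<in> start_laps"
  shows "P x \<le> roof x"
proof -
  have P: "lap_fun P" "P 0 = 0" using assms by (auto simp: start_laps_def)
  let ?r = "x mod period"
  have r: "?r < period" using a_pos by simp
  have "P ?r \<le> int a * int ?r" using lap_fun_le_add(1)[OF P(1), of 0 ?r] P(2) by simp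
  moreover have "P ?r - int b * int (period - ?r) \<le> P (?r + (period - ?r))"
    by (rule lap_fun_le_add(2)[OF P(1)])
  moreover have "P (?r + (period - ?r)) = 0"
    using r P(2) lap_fun_periodic[OF P(1), of 0 1] by simp
  moreover have "int (period - ?r) = int period - int ?r" using r by simp
  ultimately have "P ?r \<le> height a b ?r" using height_eq_min[of ?r] r by simp
  then show ?thesis using lap_fun_mod[OF P(1)] by (simp add: roof_def)
qed

text \<open>A contact at or before the peak forces \<open>D 0\<close> to be at least 0 by the bound
  on climbing, a later one by the bound on sinking. This turns connection from the roof into
  connection from the origin.\<close>

lemma touching_roof_start:
  assumes "lap_fun D" and le: "\<And>x. D x \<le> roof x" and "D x = roof x"
  shows "D 0 = 0"
proof -
  let ?r = "x mod period"
  have r: "?r < period" using a_pos by simp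
  have Dr: "D ?r = height a b ?r" using assms(3) lap_fun_mod[OF assms(1)] by (simp add: roof_def)
  have "0 \<le> D 0"
  proof (cases "?r \<le> b")
    case True
    then show ?thesis using lap_fun_le_add(1)[OF assms(1), of 0 ?r] Dr by (simp add: height_def)
  next
    case False
    have "D ?r - int b * int (period - ?r) \<le> D (?r + (period - ?r))"
      by (rule lap_fun_le_add(2)[OF assms(1)])
    moreover have "D (?r + (period - ?r)) = D 0"
      using r lap_fun_periodic[OF assms(1), of 0 1] by simp
    moreover have "int (period - ?r) = int period - int ?r" using r by simp
    ultimately show ?thesis using Dr False by (simp add: height_def algebra_simps)
  qed
  then show ?thesis using le[of 0] by (simp add: roof_def height_def)
qed

lemma vert_iff: "pt x y \<in> verts (H_graph a b) \<longleftrightarrow> int period dvd y - int a * int x \<and> y \<le> roof x"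
proof -
  have "x mod period < period" using a_pos by simp
  moreover have "[y = int a * int (x mod period)] (mod int period) \<longleftrightarrow> int period dvd y - int a * int x"
    using dvd_shift_column[of "x mod period" x y] by (simp add: cong_iff_dvd_diff)
  ultimately show ?thesis
    by (simp add: H_graph_def G_graph_def G_verts_def pt_def roof_def)
qed

lemma vert_pt:
  assumes "v \<in> verts (H_graph a b)"
  shows "v = pt (fst v) (snd v)"
  using assms by (auto simp: H_graph_def G_graph_def G_verts_def pt_def)

lemma arc_iff:
  "step x y z \<in> arcs (H_graph a b) \<longleftrightarrow>
     (z = y + int a \<or> z = y - int b) \<and> pt x y \<in> verts (H_graph a b) \<and> pt (x + 1) z \<in> verts (H_graph a b)"
proof -
  have "arcs (H_graph a b) = {e. (snd e = up_nbr a b (fst e) \<or> snd e = down_nbr a b (fst e)) \<and>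
      fst e \<in> verts (H_graph a b) \<and> snd e \<in> verts (H_graph a b)}"
    by (auto simp: H_graph_def G_graph_def)
  then show ?thesis
    by (auto simp: step_def up_nbr_pt down_nbr_pt pt_eq_iff)
qed

lemma arc_step:
  assumes "(u, v) \<in> arcs (H_graph a b)" and "u = pt x y"
  obtains z where "(u, v) = step x y z" and "z = y + int a \<or> z = y - int b"
proof -
  have "v = up_nbr a b u \<or> v = down_nbr a b u"
    using assms(1) by (auto simp: H_graph_def G_graph_def)
  then show thesis using that[of "y + int a"] that[of "y - int b"] assms(2)
    by (auto simp: step_def up_nbr_pt down_nbr_pt)
qed

lemma arc_exists_step:
  assumes "e \<in> arcs (H_graph a b)"
  obtains x y z where "e = step x y z" and "z = y + int a \<or> z = y - int b"
    and "pt x y \<in> verts (H_graph a b)" and "pt (x + 1) z \<in> verts (H_graph a b)"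
proof -
  have "fst e \<in> verts (H_graph a b)" using assms by (auto simp: H_graph_def G_graph_def)
  then have "fst e = pt (fst (fst e)) (snd (fst e))" by (rule vert_pt)
  then obtain z where "e = step (fst (fst e)) (snd (fst e)) z"
      "z = snd (fst e) + int a \<or> z = snd (fst e) - int b"
    using arc_step[of "fst e" "snd e"] assms by (metis prod.collapse)
  then show thesis using that assms arc_iff by metis
qed

lemma arcs_ends_H: "arcs_ends (H_graph a b) = arcs (H_graph a b)"
  by (auto simp: arcs_ends_def arc_to_ends_def H_graph_def G_graph_def)

lemma tail_H: "tail (H_graph a b) = fst" and head_H: "head (H_graph a b) = snd"
  by (simp_all add: H_graph_def G_graph_def)

lemma origin_pt: "origin = pt 0 0"
  by (simp add: origin_def pt_def)

lemma roof_0: "roof 0 = 0"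
  by (simp add: roof_def height_def)

lemma origin_vert: "origin \<in> verts (H_graph a b)"
  by (simp add: origin_pt vert_iff roof_0)

text \<open>Weights vanish off the graph, so both potential edges may be summed even where
  \<open>H_graph\<close> lacks one of them.\<close>

lemma out_weight_H:
  assumes "weight_function (H_graph a b) w"
  shows "out_weight (H_graph a b) w (pt x y) = outflow w x y"
proof -
  let ?A = "{step x y (y + int a), step x y (y - int b)}"
  have "out_arcs (H_graph a b) (pt x y) \<subseteq> ?A"
  proof
    fix e assume "e \<in> out_arcs (H_graph a b) (pt x y)"
    then have "e \<in> arcs (H_graph a b)" "fst e = pt x y" by (auto simp: out_arcs_def tail_H)
    then obtain z where "e = step x y z" "z = y + int a \<or> z = y - int b"
      using arc_step[of "fst e" "snd e" x y] by (metis prod.collapse)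
    then show "e \<in> ?A" by blast
  qed
  moreover have "w e = 0" if "e \<in> ?A - out_arcs (H_graph a b) (pt x y)" for e
  proof -
    have "e \<notin> arcs (H_graph a b)"
      using that by (auto simp: out_arcs_def tail_H step_def)
    then show ?thesis using assms unfolding weight_function_def by blast
  qed
  ultimately have "sum w (out_arcs (H_graph a b) (pt x y)) = sum w ?A"
    by (intro sum.mono_neutral_left) auto
  \<comment> \<open>Positivity of \<open>a\<close> makes the two edges distinct, so the sum over the
    set really has two terms.\<close>
  also have "\<dots> = outflow w x y" using a_pos by (simp add: outflow_def step_eq_iff)
  finally show ?thesis by (simp add: out_weight_def)
qed

lemma in_weight_H:
  assumes "weight_function (H_graph a b) w"
  shows "in_weight (H_graph a b) w (pt (x + 1) y) = inflow w x y"
proof -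
  let ?A = "{step x (y - int a) y, step x (y + int b) y}"
  have "in_arcs (H_graph a b) (pt (x + 1) y) \<subseteq> ?A"
  proof
    fix e assume e: "e \<in> in_arcs (H_graph a b) (pt (x + 1) y)"
    then have "e \<in> arcs (H_graph a b)" by (simp add: in_arcs_def)
    then obtain x' y' z' where s: "e = step x' y' z'" "z' = y' + int a \<or> z' = y' - int b"
      by (rule arc_exists_step)
    have "snd e = pt (x + 1) y" using e by (simp add: in_arcs_def head_H)
    then have "z' = y" and c: "(x' + 1) mod period = (x + 1) mod period"
      using s by (auto simp: step_def pt_eq_iff)
    have "[x' = x] (mod period)" using c by (simp only: cong_def[symmetric] cong_add_rcancel_nat)
    then show "e \<in> ?A" using s \<open>z' = y\<close> by (auto simp: step_eq_iff cong_def)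
  qed
  moreover have "w e = 0" if "e \<in> ?A - in_arcs (H_graph a b) (pt (x + 1) y)" for e
  proof -
    have "e \<notin> arcs (H_graph a b)"
      using that by (auto simp: in_arcs_def head_H step_def)
    then show ?thesis using assms unfolding weight_function_def by blast
  qed
  ultimately have "sum w (in_arcs (H_graph a b) (pt (x + 1) y)) = sum w ?A"
    by (intro sum.mono_neutral_left) auto
  also have "\<dots> = inflow w x y" using a_pos by (simp add: inflow_def step_eq_iff)
  finally show ?thesis by (simp add: in_weight_def)
qed

text \<open>As \<open>inflow\<close> is indexed by the preceding column, column 0 must be written as
  a successor too.\<close>

lemma vert_pt_Suc:
  assumes "v \<in> verts (H_graph a b)"
  obtains x y where "v = pt (x + 1) y"
proof -
  have "v = pt (fst v + period - 1 + 1) (snd v)"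
    using vert_pt[OF assms] a_pos by (auto simp: pt_def)
  then show thesis using that by blast
qed

text \<open>On a path without repeated vertices every edge occurs at most once, so positive weight
  is enough for being covered.\<close>

lemma covered_walk_exists:
  assumes reach: "(u, v) \<in> {e. w e > 0}\<^sup>*" and u: "u \<in> verts (H_graph a b)"
    and w: "weight_function (H_graph a b) w"
  shows "\<exists>p. vwalk p (H_graph a b) \<and> hd p = u \<and> last p = v \<and> covered (H_graph a b) w p"
proof -
  \<comment> \<open>\<open>K\<close> has the vertices of \<open>H_graph\<close> but only the
    weighted edges; inside it a walk can be shortened to a path without leaving the support.\<close>
  define K where "K = H_graph a b\<lparr>arcs := {e. w e > 0}\<rparr>"
  have ends: "arcs_ends K = {e. w e > 0}"
    by (auto simp: K_def arcs_ends_def arc_to_ends_def H_graph_def G_graph_def)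
  have sub: "{e. w e > 0} \<subseteq> arcs (H_graph a b)"
    using w unfolding weight_function_def by (metis (mono_tags) less_irrefl mem_Collect_eq subsetI)
  have "\<exists>p. vwalk p K \<and> hd p = u \<and> last p = v"
    using reach
  proof (induction rule: rtrancl_induct)
    case base
    have "vwalk [u] K" using u by (intro vwalkI) (auto simp: K_def)
    then show ?case by (intro exI[of _ "[u]"]) simp
  next
    case (step q r)
    then obtain p where p: "vwalk p K" "hd p = u" "last p = q" by blast
    have "p \<noteq> []" using p(1) by auto
    have "(q, r) \<in> arcs (H_graph a b)" using step(2) sub by blast
    then have "r \<in> verts (H_graph a b)" by (auto simp: H_graph_def G_graph_def)
    then have "vwalk (p @ [r]) K"
      using p(1,3) step(2) \<open>p \<noteq> []\<close> ends
      by (intro vwalkI) (auto simp: set_vwalk_arcs_snoc vwalk_def K_def)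
    then show ?case using p \<open>p \<noteq> []\<close> by (intro exI[of _ "p @ [r]"]) simp
  qed
  then obtain p where "vpath p K" and p: "hd p = u" "last p = v"
    using vwalk_imp_ex_vpath by metis
  then have pK: "vwalk p K" and dist: "distinct p" by auto
  have "vwalk p (H_graph a b)"
    using pK sub unfolding vwalk_def ends arcs_ends_H by (auto simp: K_def)
  moreover have "covered (H_graph a b) w p"
    unfolding covered_def
  proof
    fix e
    show "count_list (vwalk_arcs p) e \<le> w e"
    proof (cases "e \<in> set (vwalk_arcs p)")
      case True
      then have "w e > 0" using pK ends by (auto simp: vwalk_def)
      then show ?thesis using count_list_le_1[OF distinct_vwalk_arcs[OF dist], of e] by linarith
    qed simp
  qed
  ultimately show ?thesis using p by blast
qed

text \<open>Covering reduces to reachability through weighted edges, and membership in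
  \<open>H_graph\<close> to the congruence inside \<open>circulation\<close> together with the bound
  by \<open>roof\<close>.\<close>

lemma balanced_weightings_iff:
  "w \<in> balanced_weightings a b n \<longleftrightarrow> circulation w \<and> total w = period * n \<and>
     (\<forall>x y. outflow w x y > 0 \<longrightarrow> y \<le> roof x) \<and>
     (\<forall>x y. outflow w x y > 0 \<longrightarrow> (origin, pt x y) \<in> {e. w e > 0}\<^sup>*)"
  (is "?L \<longleftrightarrow> ?R")
proof
  assume ?L
  then have wf: "weight_function (H_graph a b) w" and bal: "balanced (H_graph a b) w"
    and con: "origin_connected (H_graph a b) w" and tot: "has_total_weight (H_graph a b) w (period * n)"
    by (auto simp: balanced_weightings_def)
  have sub: "e \<in> arcs (H_graph a b)" if "w e > 0" for e
    using that wf unfolding weight_function_def by (metis less_irrefl)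
  then have eq: "{e \<in> arcs (H_graph a b). w e \<noteq> 0} = {e. w e > 0}" by auto
  have vert: "pt x y \<in> verts (H_graph a b)" if "outflow w x y > 0" for x y
    using outflow_edge[OF that] sub arc_iff by metis
  have vert': "pt (x + 1) y \<in> verts (H_graph a b)" if "inflow w x y > 0" for x y
  proof -
    from that have "w (step x (y - int a) y) > 0 \<or> w (step x (y + int b) y) > 0"
      by (auto simp: inflow_def)
    then show ?thesis using sub arc_iff by metis
  qed
  have "inflow w x y = outflow w (x + 1) y" for x y
  proof (cases "pt (x + 1) y \<in> verts (H_graph a b)")
    case True
    then show ?thesis
      using bal in_weight_H[OF wf] out_weight_H[OF wf] by (metis balanced_def)
  next
    case False
    \<comment> \<open>Away from the vertices of \<open>H_graph\<close> both flows are 0.\<close>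
    then show ?thesis using vert[of "x + 1" y] vert'[of x y] by linarith
  qed
  moreover have "\<exists>x y z. int period dvd y - int a * int x \<and> (z = y + int a \<or> z = y - int b) \<and> e = step x y z"
    if "w e > 0" for e
    using arc_exists_step[OF sub[OF that]] vert_iff by metis
  ultimately have "circulation w"
    using tot eq by (simp add: circulation_def has_total_weight_def)
  moreover have "total w = period * n"
    using tot unfolding has_total_weight_def eq total_def by blast
  moreover have "y \<le> roof x" if "outflow w x y > 0" for x y
    using vert[OF that] vert_iff by blast
  moreover have "(origin, pt x y) \<in> {e. w e > 0}\<^sup>*" if pos: "outflow w x y > 0" for x y
  proof -
    obtain p where p: "vwalk p (H_graph a b)" "hd p = origin" "last p = pt x y"
        "covered (H_graph a b) w p"
      using con vert[OF pos] pos out_weight_H[OF wf, of x y] unfolding origin_connected_def by fastforce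
    have "w e > 0" if "e \<in> set (vwalk_arcs p)" for e
    proof -
      have "e \<in> arcs (H_graph a b)" using p(1) that arcs_ends_H by (auto simp: vwalk_def)
      moreover have "count_list (vwalk_arcs p) e \<noteq> 0" using that by (simp add: count_list_0_iff)
      ultimately show ?thesis using p(4) by (fastforce simp: covered_def)
    qed
    then have "set (vwalk_arcs p) \<subseteq> {e. w e > 0}" by blast
    then show ?thesis using reach_vwalk[OF p(1)] p(2,3) by metis
  qed
  ultimately show ?R by blast
next
  assume R: ?R
  then have w: "circulation w" by blast
  have vert: "pt x y \<in> verts (H_graph a b)" if "outflow w x y > 0" for x y
    using R that outflow_dvd[OF w that] vert_iff by blast
  have sub: "e \<in> arcs (H_graph a b)" if pos: "w e > 0" for e
  proof -
    obtain x y z where s: "e = step x y z" "z = y + int a \<or> z = y - int b"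
      using circulationD(1)[OF w pos] by blast
    then show ?thesis
      using arc_iff vert outflow_tail[OF w] outflow_head[OF w] pos by metis
  qed
  then have wf: "weight_function (H_graph a b) w" by (auto simp: weight_function_def)
  have eq: "{e \<in> arcs (H_graph a b). w e \<noteq> 0} = {e. w e > 0}" using sub by auto
  have "balanced (H_graph a b) w"
    unfolding balanced_def
  proof
    fix v assume "v \<in> verts (H_graph a b)"
    then obtain x y where "v = pt (x + 1) y" by (rule vert_pt_Suc)
    then show "in_weight (H_graph a b) w v = out_weight (H_graph a b) w v"
      using in_weight_H[OF wf] out_weight_H[OF wf] circulationD(3)[OF w] by simp
  qed
  moreover have "origin_connected (H_graph a b) w"
    unfolding origin_connected_def
  proof (intro ballI impI)
    fix v assume "v \<in> verts (H_graph a b)" and pos: "out_weight (H_graph a b) w v > 0"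
    then have v: "v = pt (fst v) (snd v)" using vert_pt by blast
    then have "outflow w (fst v) (snd v) > 0" using pos out_weight_H[OF wf] by metis
    then have "(origin, v) \<in> {e. w e > 0}\<^sup>*" using R v by metis
    then show "\<exists>p. vwalk p (H_graph a b) \<and> hd p = origin \<and> last p = v \<and> covered (H_graph a b) w p"
      using covered_walk_exists origin_vert wf by blast
  qed
  moreover have "has_total_weight (H_graph a b) w (period * n)"
    using R circulationD(2)[OF w] unfolding has_total_weight_def eq total_def by blast
  ultimately show ?L using wf by (simp add: balanced_weightings_def)
qed

text \<open>A path from the roof forces the crest to touch the roof, hence to pass through the
  origin, from where one follows the crest to the start of the path. Conversely, the origin lies on
  the roof.\<close>

lemma hanging_roof: "hanging n roof = balanced_weightings a b n"
proof (intro equalityI subsetI)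
  fix w assume w: "w \<in> hanging n roof"
  have "(origin, pt x y) \<in> {e. w e > 0}\<^sup>*" if pos: "outflow w x y > 0" for x y
  proof -
    obtain e where "w e > 0" using outflow_edge[OF pos] by blast
    then obtain D where D: "lap_fun D" "\<And>x. w (step x (D x) (D (x + 1))) > 0"
        "\<And>x y. outflow w x y > 0 \<Longrightarrow> y \<le> D x"
      using crest_exists[OF hangingD(1)[OF w]] by metis
    obtain x' where x': "(pt x' (roof x'), pt x y) \<in> {e. w e > 0}\<^sup>*"
      using hangingD(4)[OF w pos] by blast
    have le: "D x \<le> roof x" for x
      using hangingD(3)[OF w outflow_tail[OF hangingD(1)[OF w] D(2)]] .
    have "roof x' \<le> D x'" using D(3) outflow_reach_source[OF hangingD(1)[OF w] x' pos] by blast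
    then have eq: "D x' = roof x'" using le[of x'] by simp
    then have "D 0 = 0" using touching_roof_start[OF D(1) le] by blast
    then have "(origin, pt x' (roof x')) \<in> {e. w e > 0}\<^sup>*"
      using reach_along_lap[OF D(1), of w 0 x', OF D(2)] eq origin_pt by simp
    then show ?thesis using x' by (rule rtrancl_trans)
  qed
  then show "w \<in> balanced_weightings a b n"
    using hangingD[OF w] unfolding balanced_weightings_iff by blast
next
  fix w assume "w \<in> balanced_weightings a b n"
  then show "w \<in> hanging n roof"
    unfolding balanced_weightings_iff hanging_def origin_pt mem_Collect_eq using roof_0 by metis
qed

section \<open>Walks from the origin in coordinates\<close>

lemma walk_arc:
  assumes "vwalk p (H_graph a b)" and "i + 1 < length p"
  shows "(p ! i, p ! (i + 1)) \<in> arcs (H_graph a b)"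
proof -
  have "(p ! i, p ! (i + 1)) \<in> set (vwalk_arcs p)"
    using assms(2) unfolding vwalk_arcs_eq_map by auto
  then show ?thesis using assms(1) arcs_ends_H by (auto simp: vwalk_def)
qed

lemma walk_coordinates:
  assumes "vwalk p (H_graph a b)" and "hd p = origin"
  shows "i < length p \<Longrightarrow> p ! i = pt i (snd (p ! i))"
    and "i + 1 < length p \<Longrightarrow> snd (p ! (i + 1)) = snd (p ! i) + int a \<or>
           snd (p ! (i + 1)) = snd (p ! i) - int b"
proof -
  have next_pt: "p ! (i + 1) = pt (i + 1) (snd (p ! (i + 1))) \<and>
      (snd (p ! (i + 1)) = snd (p ! i) + int a \<or> snd (p ! (i + 1)) = snd (p ! i) - int b)"
    if "i + 1 < length p" and i: "p ! i = pt i (snd (p ! i))" for i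
  proof -
    obtain z where "(p ! i, p ! (i + 1)) = step i (snd (p ! i)) z"
        "z = snd (p ! i) + int a \<or> z = snd (p ! i) - int b"
      using walk_arc[OF assms(1) \<open>i + 1 < length p\<close>] i by (rule arc_step)
    then show ?thesis by (auto simp: step_def pt_def)
  qed
  show coords: "p ! i = pt i (snd (p ! i))" if "i < length p" for i
    using that
  proof (induction i)
    case 0
    then show ?case using assms(2) by (simp add: hd_conv_nth origin_pt pt_def)
  next
    case (Suc i)
    then show ?case using next_pt[of i] by simp
  qed
  show "snd (p ! (i + 1)) = snd (p ! i) + int a \<or> snd (p ! (i + 1)) = snd (p ! i) - int b"
    if "i + 1 < length p"
    using next_pt[OF that] coords[of i] that by simp
qed

section \<open>Lap cycles as vertex lists\<close>

definition trace :: "(nat \<Rightarrow> int) \<Rightarrow> vertex list" where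
  "trace P = map (\<lambda>x. pt x (P x)) [0..<period + 1]"

lemma trace_nth: "i \<le> period \<Longrightarrow> trace P ! i = pt i (P i)"
  unfolding trace_def by (subst nth_map) (auto simp del: upt_Suc)

lemma length_trace: "length (trace P) = period + 1"
  by (simp add: trace_def)

text \<open>By \<open>start_lap_le_roof\<close> every lap cycle of \<open>G_graph\<close> from the
  origin stays in \<open>H_graph\<close>, so all functions in \<open>start_laps\<close>
  occur.\<close>

lemma bij_betw_trace:
  "bij_betw trace start_laps {p. lap_cycle a b (H_graph a b) p \<and> hd p = origin}"
  unfolding bij_betw_def
proof
  show "inj_on trace start_laps"
  proof (rule inj_onI)
    fix P Q assume PQ: "P \<in> start_laps" "Q \<in> start_laps" and eq: "trace P = trace Q"
    have "P x = Q x" for x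
    proof -
      have r: "x mod period \<le> period" using a_pos by (simp add: less_imp_le)
      have "P (x mod period) = Q (x mod period)"
        using eq trace_nth[OF r, of P] trace_nth[OF r, of Q] by (simp add: pt_eq_iff)
      then show ?thesis
        using PQ lap_fun_mod[of P x] lap_fun_mod[of Q x] by (simp add: start_laps_def)
    qed
    then show "P = Q" by blast
  qed
  show "trace ` start_laps = {p. lap_cycle a b (H_graph a b) p \<and> hd p = origin}"
  proof (intro equalityI subsetI)
    fix p assume "p \<in> trace ` start_laps"
    then obtain P where P: "P \<in> start_laps" and p: "p = trace P" by blast
    then have lap: "lap_fun P" "P 0 = 0" by (auto simp: start_laps_def)
    have ne: "p \<noteq> []" using length_trace[of P] p by auto
    have hd: "hd p = origin"
      using ne trace_nth[of 0 P] p lap by (simp add: hd_conv_nth origin_pt)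
    have last: "last p = origin"
      using ne trace_nth[of period P] p lap_fun_periodic[OF lap(1), of 0 1] lap(2) pt_add_period[of 0 1 0]
      by (simp add: last_conv_nth length_trace origin_pt)
    have vert: "pt x (P x) \<in> verts (H_graph a b)" for x
      using vert_iff lap_fun_dvd[OF lap(1)] start_lap_le_roof[OF P] by blast
    have "step x (P x) (P (x + 1)) \<in> arcs (H_graph a b)" for x
      using arc_iff vert lap_fun_step[OF lap(1)] by blast
    moreover have "set (vwalk_arcs p) \<subseteq> range (\<lambda>x. step x (P x) (P (x + 1)))"
      unfolding vwalk_arcs_eq_map p length_trace by (auto simp: trace_nth step_def)
    ultimately have "set (vwalk_arcs p) \<subseteq> arcs_ends (H_graph a b)"
      unfolding arcs_ends_H by blast
    moreover have "set p \<subseteq> verts (H_graph a b)" using vert by (auto simp: p trace_def)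
    ultimately have "vwalk p (H_graph a b)" using ne by blast
    then show "p \<in> {p. lap_cycle a b (H_graph a b) p \<and> hd p = origin}"
      using hd last
      by (simp add: lap_cycle_def lap_def cycle_walk_def weld_point_def origin_def p length_trace)
  next
    fix p assume "p \<in> {p. lap_cycle a b (H_graph a b) p \<and> hd p = origin}"
    then have p: "vwalk p (H_graph a b)" "length p - 1 = period" "hd p = origin" "last p = origin"
      by (auto simp: lap_cycle_def lap_def cycle_walk_def)
    have ne: "p \<noteq> []" using p(1) by auto
    then have len: "length p = period + 1" using p(2) by (cases p) auto
    note c = walk_coordinates[OF p(1,3)]
    \<comment> \<open>Indexing modulo the period makes \<open>P\<close> periodic at once; the last
      entry agrees with it because the cycle is closed.\<close>
    define P where "P x = snd (p ! (x mod period))" for x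
    have p_last: "p ! period = origin" using p(4) ne len by (simp add: last_conv_nth)
    have p_0: "p ! 0 = origin" using p(3) ne by (simp add: hd_conv_nth)
    have r: "x mod period < period" for x using a_pos by simp
    have P_eq: "snd (p ! x) = P x" if "x \<le> period" for x
      using that p_last p_0 by (cases "x = period") (auto simp: P_def)
    have "P (x + 1) = P x + int a \<or> P (x + 1) = P x - int b" for x
    proof -
      have "P (x mod period + 1) = P (x + 1)" by (simp add: P_def mod_simps)
      then have "snd (p ! (x mod period + 1)) = P (x + 1)" using P_eq[of "x mod period + 1"] r[of x] by simp
      then show ?thesis using c(2)[of "x mod period"] r[of x] len by (simp add: P_def)
    qed
    then have "lap_fun P" using p_0 by (auto simp: lap_fun_def P_def origin_def)
    moreover have "P 0 = 0" using p_0 by (simp add: P_def origin_def)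
    moreover have "trace P = p"
    proof (rule nth_equalityI)
      fix i assume "i < length (trace P)"
      then have "i \<le> period" by (simp add: length_trace)
      then show "trace P ! i = p ! i" using c(1)[of i] P_eq[of i] len by (simp add: trace_nth)
    qed (simp add: length_trace len)
    ultimately show "p \<in> trace ` start_laps" by (force simp: start_laps_def)
  qed
qed

lemma bij_betw_stacked_lap_cycles:
  "bij_betw (map trace) {Ps. length Ps = n \<and> set Ps \<subseteq> start_laps} (lap_cycle_sequences a b n)"
proof -
  have "lap_cycle_sequences a b n =
      {ps. length ps = n \<and> set ps \<subseteq> {p. lap_cycle a b (H_graph a b) p \<and> hd p = origin}}"
    by (auto simp: lap_cycle_sequences_def)
  then show ?thesis using bij_betw_map_lists_length[OF bij_betw_trace] by simp
qed

section \<open>Downs-first cycles\<close>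

definition arc_count :: "vertex list \<Rightarrow> edge \<Rightarrow> nat" where
  "arc_count p = count_list (vwalk_arcs p)"

text \<open>Counting positions lets two walks be compared along a common initial segment.\<close>

lemma arc_count_eq_card:
  "arc_count p (u, v) = card {k. k + 1 < length p \<and> p ! k = u \<and> p ! (k + 1) = v}"
proof -
  have "arc_count p (u, v) = card {k. k < length p - 1 \<and> vwalk_arcs p ! k = (u, v)}"
    using vwalk_length_simp[of p] unfolding vwalk_length_def
    by (simp add: arc_count_def count_list_eq_length_filter length_filter_conv_card eq_commute[of "(u, v)"])
  also have "{k. k < length p - 1 \<and> vwalk_arcs p ! k = (u, v)}
      = {k. k + 1 < length p \<and> p ! k = u \<and> p ! (k + 1) = v}"
    by (auto simp: vwalk_arcs_eq_map)
  finally show ?thesis .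
qed

lemma flow_of_arc:
  assumes "e \<in> arcs (H_graph a b)"
  shows "outflow (\<lambda>e'. of_bool (e = e')) x y = of_bool (fst e = pt x y)"
    and "inflow (\<lambda>e'. of_bool (e = e')) x y = of_bool (snd e = pt (x + 1) y)"
proof -
  obtain x' y' z' where s: "e = step x' y' z'" "z' = y' + int a \<or> z' = y' - int b"
    using assms by (rule arc_exists_step)
  have c: "x' mod period = x mod period \<longleftrightarrow> (x' + 1) mod period = (x + 1) mod period"
    by (simp only: cong_def[symmetric] cong_add_rcancel_nat)
  show "outflow (\<lambda>e'. of_bool (e = e')) x y = of_bool (fst e = pt x y)"
    using s(2) a_pos unfolding s(1) outflow_def step_eq_iff by (auto simp: step_def pt_eq_iff)
  show "inflow (\<lambda>e'. of_bool (e = e')) x y = of_bool (snd e = pt (x + 1) y)"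
    using s(2) a_pos unfolding s(1) inflow_def step_eq_iff c by (auto simp: step_def pt_eq_iff)
qed

text \<open>Departures happen at all entries but the last, arrivals at all but the first.\<close>

lemma flow_arc_count:
  assumes "vwalk p (H_graph a b)"
  shows "outflow (arc_count p) x y = count_list (butlast p) (pt x y)"
    and "inflow (arc_count p) x y = count_list (tl p) (pt (x + 1) y)"
proof -
  have "outflow (arc_count p) x y = count_list (butlast p) (pt x y) \<and>
      inflow (arc_count p) x y = count_list (tl p) (pt (x + 1) y)"
    using assms
  proof (induction rule: vwalk_induct)
    case (Base u)
    then show ?case by (simp add: arc_count_def outflow_def inflow_def)
  next
    case (Cons u v es)
    have e: "(u, v) \<in> arcs (H_graph a b)" using Cons arcs_ends_H by simp
    have "arc_count (u # v # es) = (\<lambda>e. arc_count (v # es) e + of_bool ((u, v) = e))"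
      by (auto simp: arc_count_def)
    then show ?case
      using Cons.IH flow_of_arc[OF e] by (auto simp: outflow_add inflow_add)
  qed
  then show "outflow (arc_count p) x y = count_list (butlast p) (pt x y)"
    and "inflow (arc_count p) x y = count_list (tl p) (pt (x + 1) y)" by auto
qed

text \<open>Both sides count the occurrences of the vertex in \<open>p\<close>, once with the first
  and once with the last entry split off.\<close>

lemma arc_count_conservation:
  assumes "vwalk p (H_graph a b)"
  shows "inflow (arc_count p) x y + of_bool (hd p = pt (x + 1) y)
       = outflow (arc_count p) (x + 1) y + of_bool (last p = pt (x + 1) y)"
proof -
  have ne: "p \<noteq> []" using assms by auto
  have "count_list p v = of_bool (hd p = v) + count_list (tl p) v" for v
    using ne by (cases p) auto
  moreover have "count_list p v = count_list (butlast p) v + of_bool (last p = v)" for v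
    using count_list_append[of "butlast p" "[last p]" v] ne by simp
  ultimately show ?thesis using flow_arc_count[OF assms] by (metis add.commute)
qed

lemma arc_count_pos: "arc_count p e > 0 \<longleftrightarrow> e \<in> set (vwalk_arcs p)"
  using count_list_0_iff[of "vwalk_arcs p" e] by (auto simp: arc_count_def)

lemma circulation_arc_count:
  assumes "vwalk p (H_graph a b)" and "hd p = last p"
  shows "circulation (arc_count p)"
proof -
  have "\<exists>x y z. int period dvd y - int a * int x \<and> (z = y + int a \<or> z = y - int b) \<and> e = step x y z"
    if "arc_count p e > 0" for e
  proof -
    have "e \<in> arcs (H_graph a b)" using that assms(1) arcs_ends_H by (auto simp: arc_count_pos vwalk_def)
    then show ?thesis using arc_exists_step vert_iff by metis
  qed
  moreover have "finite {e. arc_count p e > 0}" by (simp add: arc_count_pos)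
  moreover have "inflow (arc_count p) x y = outflow (arc_count p) (x + 1) y" for x y
    using arc_count_conservation[OF assms(1), of x y] assms(2) by simp
  ultimately show ?thesis by (simp add: circulation_def)
qed

lemma total_arc_count: "total (arc_count p) = length p - 1"
proof -
  have "total (arc_count p) = sum (count_list (vwalk_arcs p)) (set (vwalk_arcs p))"
    unfolding total_def arc_count_pos by (simp add: arc_count_def)
  also have "\<dots> = length p - 1"
    by (simp add: sum_count_set vwalk_length_simp[unfolded vwalk_length_def])
  finally show ?thesis .
qed

text \<open>The initial segments of the cycle itself connect the origin to every vertex that the
  cycle leaves.\<close>

lemma arc_count_in_weightings:
  assumes "p \<in> downs_first_cycles a b n"
  shows "arc_count p \<in> balanced_weightings a b n"
proof -
  have p: "vwalk p (H_graph a b)" "hd p = last p" "hd p = origin" "length p - 1 = period * n"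
    using assms by (auto simp: downs_first_cycles_def cycle_walk_def)
  note w = circulation_arc_count[OF p(1,2)]
  have "y \<le> roof x" if pos: "outflow (arc_count p) x y > 0" for x y
  proof -
    obtain z where "step x y z \<in> set (vwalk_arcs p)"
      using outflow_edge[OF pos] by (auto simp: arc_count_pos)
    then have "step x y z \<in> arcs (H_graph a b)" using p(1) arcs_ends_H by (auto simp: vwalk_def)
    then show ?thesis using arc_iff vert_iff by blast
  qed
  moreover have "(origin, pt x y) \<in> {e. arc_count p e > 0}\<^sup>*"
    if "outflow (arc_count p) x y > 0" for x y
  proof -
    have reach: "i < length p \<Longrightarrow> (origin, p ! i) \<in> {e. arc_count p e > 0}\<^sup>*" for i
    proof (induction i)
      case 0
      then show ?case using p(3) by (simp add: hd_conv_nth)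
    next
      case (Suc i)
      then have "(p ! i, p ! Suc i) \<in> {e. arc_count p e > 0}"
        by (auto simp: arc_count_pos vwalk_arcs_eq_map)
      then show ?case using Suc by (auto intro: rtrancl_into_rtrancl)
    qed
    have "pt x y \<in> set (butlast p)"
      using that flow_arc_count(1)[OF p(1)] count_list_0_iff by (metis less_irrefl)
    then show ?thesis using reach by (metis in_set_butlastD in_set_conv_nth)
  qed
  ultimately show ?thesis
    using w total_arc_count[of p] p(4) by (simp add: balanced_weightings_iff)
qed

lemma downs_firstD:
  assumes "downs_first a b p" and "i + 1 < length p" "p ! i = v" "p ! (i + 1) = down_nbr a b v"
    and "j + 1 < length p" "p ! j = v" "p ! (j + 1) = up_nbr a b v"
  shows "i < j"
proof -
  have "i < vwalk_length p" and "j < vwalk_length p" using assms(2,5) by auto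
  then show ?thesis using assms unfolding downs_first_def by blast
qed

text \<open>At the first disagreement one walk goes down from a vertex and the other goes up. The
  latter has then made all its down-steps from there within the common segment, whereas the former
  makes at least one more, against the equal counts.\<close>

lemma inj_on_arc_count: "inj_on arc_count (downs_first_cycles a b n)"
proof (rule inj_onI)
  fix p q
  assume p: "p \<in> downs_first_cycles a b n" and q: "q \<in> downs_first_cycles a b n"
    and eq: "arc_count p = arc_count q"
  \<comment> \<open>Stated for arbitrary walks, because it is applied in both orders.\<close>
  have no_split: False
    if p: "p \<in> downs_first_cycles a b n" and q: "q \<in> downs_first_cycles a b n"
      and eq: "arc_count p = arc_count q" and len: "i + 1 < length p" "length q = length p"
      and agree: "\<forall>k\<le>i. p ! k = q ! k"
      and down: "p ! (i + 1) = down_nbr a b (p ! i)" and up: "q ! (i + 1) = up_nbr a b (p ! i)"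
    for p q i
  proof -
    let ?A = "\<lambda>p'. {k. k + 1 < length p' \<and> p' ! k = p ! i \<and> p' ! (k + 1) = down_nbr a b (p ! i)}"
    have df: "downs_first a b q" using q by (simp add: downs_first_cycles_def)
    have before: "k < i" if "k \<in> ?A q" for k
    proof -
      have "i + 1 < length q" "q ! i = p ! i" using len agree by auto
      then show ?thesis using downs_firstD[OF df _ _ _ _ _ up] that by blast
    qed
    have "?A q \<subseteq> ?A p - {i}"
    proof
      fix k assume k: "k \<in> ?A q"
      then have "k < i" by (rule before)
      then have "p ! k = q ! k" "p ! (k + 1) = q ! (k + 1)" using agree by auto
      then show "k \<in> ?A p - {i}" using k len \<open>k < i\<close> by simp
    qed
    moreover have "i \<in> ?A p" using len down by simp
    moreover have fin: "finite (?A p)" by (rule finite_subset[of _ "{..length p}"]) auto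
    ultimately have "card (?A q) < card (?A p)" by (intro psubset_card_mono) auto
    then show False
      using fun_cong[OF eq, of "(p ! i, down_nbr a b (p ! i))"] by (simp only: arc_count_eq_card)
  qed
  have pw: "vwalk p (H_graph a b)" "hd p = origin" "length p - 1 = period * n"
    and qw: "vwalk q (H_graph a b)" "hd q = origin" "length q - 1 = period * n"
    using p q by (auto simp: downs_first_cycles_def cycle_walk_def)
  have ne: "p \<noteq> []" "q \<noteq> []" using pw(1) qw(1) by auto
  then have len: "length q = length p" using pw(3) qw(3) by (cases p; cases q) auto
  have nbr: "r ! (i + 1) = up_nbr a b (r ! i) \<or> r ! (i + 1) = down_nbr a b (r ! i)"
    if "vwalk r (H_graph a b)" "i + 1 < length r" for r i
    using walk_arc[OF that] by (auto simp: H_graph_def G_graph_def)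
  have "i < length p \<longrightarrow> p ! i = q ! i" for i
  proof (induction i rule: less_induct)
    case (less i)
    show ?case
    proof (cases i)
      case 0
      then show ?thesis using pw(2) qw(2) ne by (simp add: hd_conv_nth)
    next
      case (Suc j)
      show ?thesis
      proof
        assume "i < length p"
        then have j: "j + 1 < length p" "\<forall>k\<le>j. p ! k = q ! k" using Suc less by auto
        have pq: "p ! j = q ! j" using j(2) by simp
        have qj: "j + 1 < length q" "length p = length q" "\<forall>k\<le>j. q ! k = p ! k" using j len by auto
        consider "p ! (j + 1) = q ! (j + 1)"
          | "p ! (j + 1) = down_nbr a b (p ! j)" "q ! (j + 1) = up_nbr a b (p ! j)"
          | "q ! (j + 1) = down_nbr a b (q ! j)" "p ! (j + 1) = up_nbr a b (q ! j)"
          using nbr[OF pw(1) j(1)] nbr[OF qw(1) qj(1)] pq by metis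
        then have "p ! (j + 1) = q ! (j + 1)"
        proof cases
          case 2
          then show ?thesis using no_split[OF p q eq j(1) len j(2)] by blast
        next
          case 3
          then show ?thesis using no_split[OF q p eq[symmetric] qj] by blast
        qed
        then show "p ! i = q ! i" using Suc by simp
      qed
    qed
  qed
  then show "p = q" using len by (intro nth_equalityI) auto
qed

text \<open>All initial segments of the greedy walk are included; the complete walk is obtained
  later as one of maximal length.\<close>

inductive greedy :: "(edge \<Rightarrow> nat) \<Rightarrow> vertex list \<Rightarrow> bool" for w :: "edge \<Rightarrow> nat" where
  start: "greedy w [origin]"
| down: "greedy w p \<Longrightarrow> v = last p \<Longrightarrow> arc_count p (v, down_nbr a b v) < w (v, down_nbr a b v) \<Longrightarrow>
    greedy w (p @ [down_nbr a b v])"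
| up: "greedy w p \<Longrightarrow> v = last p \<Longrightarrow> arc_count p (v, down_nbr a b v) = w (v, down_nbr a b v) \<Longrightarrow>
    arc_count p (v, up_nbr a b v) < w (v, up_nbr a b v) \<Longrightarrow> greedy w (p @ [up_nbr a b v])"

lemma up_neq_down: "up_nbr a b v \<noteq> down_nbr a b v"
  using a_pos by (simp add: up_nbr_def down_nbr_def)

lemma arc_count_snoc:
  assumes "p \<noteq> []"
  shows "arc_count (p @ [u]) e = arc_count p e + of_bool (e = (last p, u))"
  using assms by (auto simp: arc_count_def vwalk_arcs_append)

lemma greedy_nonempty: "greedy w p \<Longrightarrow> p \<noteq> []"
  by (induction rule: greedy.induct) auto

lemma greedy_hd: "greedy w p \<Longrightarrow> hd p = origin"
  by (induction rule: greedy.induct) (auto simp: greedy_nonempty)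

lemma greedy_le: "greedy w p \<Longrightarrow> arc_count p e \<le> w e"
proof (induction rule: greedy.induct)
  case start
  then show ?case by (simp add: arc_count_def)
qed (auto simp: arc_count_snoc greedy_nonempty)

lemma greedy_vwalk:
  assumes "greedy w p" and "weight_function (H_graph a b) w"
  shows "vwalk p (H_graph a b)"
proof
  show ne: "p \<noteq> []" using greedy_nonempty[OF assms(1)] .
  have arc: "e \<in> arcs (H_graph a b)" if "e \<in> set (vwalk_arcs p)" for e
  proof -
    have "arc_count p e > 0" using that by (simp add: arc_count_pos)
    then have "w e \<noteq> 0" using greedy_le[OF assms(1), of e] by simp
    then show ?thesis using assms(2) unfolding weight_function_def by metis
  qed
  then show "set (vwalk_arcs p) \<subseteq> arcs_ends (H_graph a b)" unfolding arcs_ends_H by blast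
  show "set p \<subseteq> verts (H_graph a b)"
  proof
    fix u assume "u \<in> set p"
    then obtain i where i: "i < length p" "u = p ! i" by (auto simp: in_set_conv_nth)
    show "u \<in> verts (H_graph a b)"
    proof (cases i)
      case 0
      then show ?thesis using i ne greedy_hd[OF assms(1)] origin_vert by (simp add: hd_conv_nth)
    next
      case (Suc j)
      then have "(p ! j, u) \<in> set (vwalk_arcs p)" using i by (auto simp: vwalk_arcs_eq_map)
      then show ?thesis using arc by (fastforce simp: H_graph_def G_graph_def)
    qed
  qed
qed

text \<open>The first up-step from a vertex requires a saturated down-edge, and saturation lasts
  since no weight is ever exceeded.\<close>

lemma greedy_up_saturates_down:
  assumes "greedy w p" and "arc_count p (v, up_nbr a b v) > 0"
  shows "arc_count p (v, down_nbr a b v) = w (v, down_nbr a b v)"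
  using assms
proof (induction rule: greedy.induct)
  case start
  then show ?case by (simp add: arc_count_def)
next
  case (down p u)
  then have ne: "p \<noteq> []" by (simp add: greedy_nonempty)
  have "arc_count p (v, up_nbr a b v) > 0"
    using down.prems up_neq_down[of v] down.hyps(2) by (auto simp: arc_count_snoc[OF ne] split: if_splits)
  then show ?case using down ne by (auto simp: arc_count_snoc)
next
  case (up p u)
  then have ne: "p \<noteq> []" by (simp add: greedy_nonempty)
  show ?case
  proof (cases "v = u")
    case True
    then show ?thesis using up up_neq_down[of v] by (simp add: arc_count_snoc[OF ne])
  next
    case False
    then show ?thesis using up by (simp add: arc_count_snoc[OF ne])
  qed
qed

text \<open>A new up-step comes last and cannot violate the order. A new down-step uses spare
  weight, so by \<open>greedy_up_saturates_down\<close> no up-step has left that vertex yet.\<close>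

lemma greedy_downs_first:
  assumes "greedy w p"
  shows "downs_first a b p"
  using assms
proof (induction rule: greedy.induct)
  case start
  then show ?case by (simp add: downs_first_def)
next
  case (down p u)
  then have ne: "p \<noteq> []" by (simp add: greedy_nonempty)
  have no_up: "arc_count p (u, up_nbr a b u) = 0"
    using greedy_up_saturates_down[OF down.hyps(1), of u] down.hyps(3) by (cases "arc_count p (u, up_nbr a b u)") auto
  show ?case
    unfolding downs_first_def
  proof (intro allI impI, elim conjE)
    fix v i j
    assume i: "i < vwalk_length (p @ [down_nbr a b u])" "(p @ [down_nbr a b u]) ! i = v"
        "(p @ [down_nbr a b u]) ! (i + 1) = down_nbr a b v"
      and j: "j < vwalk_length (p @ [down_nbr a b u])" "(p @ [down_nbr a b u]) ! j = v"
        "(p @ [down_nbr a b u]) ! (j + 1) = up_nbr a b v"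
    have last: "p ! (length p - 1) = u" using ne down.hyps(2) by (simp add: last_conv_nth)
    have "j + 1 \<noteq> length p"
    proof
      assume "j + 1 = length p"
      then have "(p @ [down_nbr a b u]) ! (j + 1) = down_nbr a b u" by (simp add: nth_append)
      moreover have "(p @ [down_nbr a b u]) ! j = u"
        using last \<open>j + 1 = length p\<close> by (metis add_diff_cancel_right' less_add_one nth_append)
      ultimately show False using j up_neq_down by metis
    qed
    then have jp: "j + 1 < length p" "p ! j = v" "p ! (j + 1) = up_nbr a b v"
      using j by (auto simp: nth_append split: if_splits)
    then have "arc_count p (v, up_nbr a b v) > 0" by (auto simp: arc_count_pos vwalk_arcs_eq_map)
    then have "v \<noteq> u" using no_up by auto
    have "i + 1 \<noteq> length p"
    proof
      assume "i + 1 = length p"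
      then have "i = length p - 1" by simp
      then show False using i(2) last ne \<open>v \<noteq> u\<close> by (simp add: nth_append)
    qed
    then have "i + 1 < length p" "p ! i = v" "p ! (i + 1) = down_nbr a b v"
      using i by (auto simp: nth_append split: if_splits)
    then show "i < j" using downs_firstD[OF down.IH] jp by blast
  qed
next
  case (up p u)
  then have ne: "p \<noteq> []" by (simp add: greedy_nonempty)
  show ?case
    unfolding downs_first_def
  proof (intro allI impI, elim conjE)
    fix v i j
    assume i: "i < vwalk_length (p @ [up_nbr a b u])" "(p @ [up_nbr a b u]) ! i = v"
        "(p @ [up_nbr a b u]) ! (i + 1) = down_nbr a b v"
      and j: "j < vwalk_length (p @ [up_nbr a b u])" "(p @ [up_nbr a b u]) ! j = v"
        "(p @ [up_nbr a b u]) ! (j + 1) = up_nbr a b v"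
    have last: "p ! (length p - 1) = u" using ne up.hyps(2) by (simp add: last_conv_nth)
    have "i + 1 \<noteq> length p"
    proof
      assume "i + 1 = length p"
      then have "(p @ [up_nbr a b u]) ! (i + 1) = up_nbr a b u" by (simp add: nth_append)
      moreover have "(p @ [up_nbr a b u]) ! i = u"
        using last \<open>i + 1 = length p\<close> by (metis add_diff_cancel_right' less_add_one nth_append)
      ultimately show False using i up_neq_down by metis
    qed
    then have ip: "i + 1 < length p" "p ! i = v" "p ! (i + 1) = down_nbr a b v"
      using i by (auto simp: nth_append split: if_splits)
    show "i < j"
    proof (cases "j + 1 = length p")
      case False
      then have "j + 1 < length p" "p ! j = v" "p ! (j + 1) = up_nbr a b v"
        using j by (auto simp: nth_append split: if_splits)
      then show ?thesis using downs_firstD[OF up.IH] ip by blast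
    qed (use ip in simp)
  qed
qed

text \<open>The total weight bounds the length, so a longest greedy walk exists; at its end neither
  rule for extension applies.\<close>

lemma greedy_maximal:
  assumes "circulation w"
  obtains p where "greedy w p"
    and "arc_count p (last p, down_nbr a b (last p)) = w (last p, down_nbr a b (last p))"
    and "arc_count p (last p, up_nbr a b (last p)) = w (last p, up_nbr a b (last p))"
proof -
  have bound: "length p \<le> total w + 1" if "greedy w p" for p
  proof -
    have sub: "{e. arc_count p e > 0} \<subseteq> {e. w e > 0}"
    proof
      fix e assume "e \<in> {e. arc_count p e > 0}"
      then show "e \<in> {e. w e > 0}" using greedy_le[OF that, of e] by simp
    qed
    have "total (arc_count p) = sum (arc_count p) {e. w e > 0}"
      by (rule total_superset[OF circulationD(2)[OF assms] sub])
    also have "\<dots> \<le> total w" unfolding total_def by (intro sum_mono greedy_le[OF that])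
    finally show ?thesis by (simp add: total_arc_count)
  qed
  obtain p where p: "greedy w p" and max: "\<And>q. greedy w q \<Longrightarrow> length q \<le> length p"
  proof -
    \<comment> \<open>\<open>ex_has_greatest_nat\<close> expects a strict bound, hence 2 in place of
      1.\<close>
    have "\<forall>q. greedy w q \<longrightarrow> length q < total w + 2" using bound by fastforce
    then have "\<exists>p. greedy w p \<and> (\<forall>q. greedy w q \<longrightarrow> length q \<le> length p)"
      by (rule ex_has_greatest_nat[of "greedy w" "[origin]", OF start])
    then show thesis using that by blast
  qed
  let ?v = "last p"
  have d: "arc_count p (?v, down_nbr a b ?v) = w (?v, down_nbr a b ?v)"
  proof (rule ccontr)
    assume "\<not> ?thesis"
    then have "arc_count p (?v, down_nbr a b ?v) < w (?v, down_nbr a b ?v)"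
      using greedy_le[OF p, of "(?v, down_nbr a b ?v)"] by simp
    then show False using max[OF down[OF p refl]] by simp
  qed
  have u: "arc_count p (?v, up_nbr a b ?v) = w (?v, up_nbr a b ?v)"
  proof (rule ccontr)
    assume "\<not> ?thesis"
    then have "arc_count p (?v, up_nbr a b ?v) < w (?v, up_nbr a b ?v)"
      using greedy_le[OF p, of "(?v, up_nbr a b ?v)"] by simp
    then show False using max[OF up[OF p refl d]] by simp
  qed
  show thesis using that p d u by blast
qed

lemma outflow_eq_nbrs:
  "outflow w x y = w (pt x y, up_nbr a b (pt x y)) + w (pt x y, down_nbr a b (pt x y))"
  by (simp add: outflow_def step_def up_nbr_pt down_nbr_pt)

lemma inflow_mono:
  assumes "\<And>e. w e \<le> w' e"
  shows "inflow w x y \<le> inflow w' x y"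
  unfolding inflow_def by (intro add_mono assms)

text \<open>
  The crest \<open>D\<close> of the unused weight cannot be left upwards: a \<open>w\<close>-edge doing so would be an up-edge at
  a vertex of \<open>D\<close> whose down-edge is not used up, so it would be unused itself.  Every \<open>w\<close>-edge lies
  on a lap in the support of \<open>w\<close>, and a lap entering \<open>D\<close> from above would have to leave it again.
\<close>

lemma greedy_exhausts:
  assumes w: "w \<in> balanced_weightings a b n" and p: "greedy w p" "hd p = last p"
    and sat: "outflow (arc_count p) 0 0 = outflow w 0 0"
  shows "arc_count p = w"
proof (rule ccontr)
  have W: "circulation w" "\<And>x y. outflow w x y > 0 \<Longrightarrow> y \<le> roof x"
      "\<And>x y. outflow w x y > 0 \<Longrightarrow> (origin, pt x y) \<in> {e. w e > 0}\<^sup>*"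
    using w unfolding balanced_weightings_iff by blast+
  have "weight_function (H_graph a b) w" using w by (simp add: balanced_weightings_def)
  then have walk: "vwalk p (H_graph a b)" by (rule greedy_vwalk[OF p(1)])
  note le = greedy_le[OF p(1)]
  define r where "r e = w e - arc_count p e" for e
  have r: "circulation r"
    using circulation_diff[OF W(1) circulation_arc_count[OF walk p(2)] le] by (simp add: r_def[abs_def])
  have r_le: "r e \<le> w e" for e by (simp add: r_def)
  assume "arc_count p \<noteq> w"
  then obtain e where "arc_count p e \<noteq> w e" by blast
  then have "r e > 0" using le[of e] by (simp add: r_def)
  then obtain D where D: "lap_fun D" "\<And>x. r (step x (D x) (D (x + 1))) > 0"
      "\<And>x y. outflow r x y > 0 \<Longrightarrow> y \<le> D x"
    using crest_exists[OF r] by metis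
  have onD: "outflow w x (D x) > 0" for x
    using outflow_tail[OF W(1)] D(2)[of x] r_le order_less_le_trans by blast
  \<comment> \<open>The origin is exhausted, so the crest of the rest misses it and, being bounded
    by the roof, has negative height in column 0.\<close>
  have "outflow r 0 0 = 0"
    using sat le[of "step 0 0 (int a)"] le[of "step 0 0 (- int b)"] by (simp add: outflow_def r_def)
  then have "D 0 \<noteq> 0" using outflow_tail[OF r D(2)[of 0]] by auto
  then have D0: "D 0 < 0" using W(2)[OF onD, of 0] roof_0 by simp
  have stay: "z \<le> D (x + 1)" if pos: "w (step x y z) > 0" and "y \<le> D x" for x y z
  proof (rule ccontr)
    assume "\<not> ?thesis"
    then have gt: "D (x + 1) < z" by simp
    have "int period dvd (z - int a * int (x + 1)) - (D (x + 1) - int a * int (x + 1))"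
      by (rule dvd_diff[OF outflow_dvd[OF W(1) outflow_head[OF W(1) pos]] lap_fun_dvd[OF D(1)]])
    then have "int period dvd z - D (x + 1)" by simp
    \<comment> \<open>A gap of a full period leaves only one possibility: the edge goes up from
      \<open>D x\<close> while \<open>D\<close> itself goes down.\<close>
    then have "D (x + 1) + int period \<le> z" using gt a_pos by (intro dvd_between) auto
    then have eq: "z = D x + int a" "y = D x" "D (x + 1) = D x - int b"
      using circulation_step(2)[OF W(1) pos] lap_fun_step[OF D(1), of x] \<open>y \<le> D x\<close> b_pos a_pos by auto
    let ?v = "pt x (D x)"
    have "r (?v, down_nbr a b ?v) > 0" using D(2)[of x] eq(3) by (simp add: step_def down_nbr_pt)
    then have "arc_count p (?v, up_nbr a b ?v) = 0"
      using greedy_up_saturates_down[OF p(1), of ?v]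
      by (cases "arc_count p (?v, up_nbr a b ?v)") (auto simp: r_def)
    then have "r (step x (D x) z) > 0" using pos eq(1,2) by (simp add: r_def step_def up_nbr_pt)
    then have "z \<le> D (x + 1)" by (rule D(3)[OF outflow_head[OF r]])
    then show False using gt by simp
  qed
  have enter: "y \<le> D x" if pos: "w (step x y z) > 0" and z: "z \<le> D (x + 1)" for x y z
  proof -
    obtain P where P: "lap_fun P" "\<And>x. w (step x (P x) (P (x + 1))) > 0" "step x y z \<in> lap_edges P"
      using edge_on_lap[OF W(1) pos] by metis
    have yz: "y = P x" "z = P (x + 1)" using P(3) step_in_lap_edges[OF P(1)] by auto
    have "P (x + 1 + k) \<le> D (x + 1 + k)" for k
    proof (induction k)
      case 0
      then show ?case using z yz by simp
    next
      case (Suc k)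
      then show ?case using stay[OF P(2)[of "x + 1 + k"]] by simp
    qed
    \<comment> \<open>After \<open>period - 1\<close> steps from column \<open>x + 1\<close> the lap
      is back in column \<open>x\<close>.\<close>
    from this[of "period - 1"] have "P (x + period * 1) \<le> D (x + period * 1)" using a_pos by simp
    then show ?thesis unfolding yz(1) lap_fun_periodic[OF P(1)] lap_fun_periodic[OF D(1)] .
  qed
  \<comment> \<open>By the contrapositive of \<open>enter\<close>, weighted edges lead from points
    strictly above \<open>D\<close> only to such points; yet the crest itself is reachable from the
    origin.\<close>
  have above: "\<exists>x y. q = pt x y \<and> D x < y" if "(origin, q) \<in> {e. w e > 0}\<^sup>*" for q
    using that
  proof (induction rule: rtrancl_induct)
    case base
    then show ?case using D0 origin_pt by blast
  next
    case (step q s)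
    then obtain x y where xy: "q = pt x y" "D x < y" by blast
    have pos: "w (pt x y, s) > 0" using step(2) xy by simp
    then obtain z where z: "(pt x y, s) = slopes.step a b x y z" by (rule circulation_edge[OF W(1)])
    then have "D (x + 1) < z" using enter[of x y z] pos xy(2) by force
    moreover have "s = pt (x + 1) z" using z by (simp add: step_def)
    ultimately show ?case by blast
  qed
  obtain x y where "pt 0 (D 0) = pt x y" "D x < y" using above[OF W(3)[OF onD]] by blast
  then show False using lap_fun_mod[OF D(1), of x] by (simp add: pt_eq_iff)
qed

text \<open>A walk stuck away from its start has entered its last vertex once more often than it
  left it. As the exits are used up, it would have entered more often than the balanced
  \<open>w\<close> allows.\<close>

lemma arc_count_surj:
  assumes w: "w \<in> balanced_weightings a b n"
  shows "\<exists>p \<in> downs_first_cycles a b n. arc_count p = w"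
proof -
  have W: "circulation w" "total w = period * n"
    using w unfolding balanced_weightings_iff by blast+
  have wf: "weight_function (H_graph a b) w" using w by (simp add: balanced_weightings_def)
  obtain p where p: "greedy w p"
    and d: "arc_count p (last p, down_nbr a b (last p)) = w (last p, down_nbr a b (last p))"
    and u: "arc_count p (last p, up_nbr a b (last p)) = w (last p, up_nbr a b (last p))"
    by (rule greedy_maximal[OF W(1)])
  note walk = greedy_vwalk[OF p wf]
  have "last p \<in> verts (H_graph a b)" using walk by (auto simp: vwalk_def)
  then obtain x y where xy: "last p = pt (x + 1) y" by (rule vert_pt_Suc)
  have sat: "outflow (arc_count p) (x + 1) y = outflow w (x + 1) y"
    using d u unfolding xy outflow_eq_nbrs by simp
  have "inflow (arc_count p) x y \<le> outflow w (x + 1) y"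
    using inflow_mono[of "arc_count p" w, OF greedy_le[OF p]] circulationD(3)[OF W(1)] by simp
  then have closed: "hd p = last p"
    using arc_count_conservation[OF walk, of x y] sat xy by (cases "hd p = last p") auto
  then have "pt (x + 1) y = pt 0 0" using xy greedy_hd[OF p] origin_pt by simp
  then have "outflow (arc_count p) 0 0 = outflow w 0 0" using sat outflow_pt_cong by metis
  then have eq: "arc_count p = w" using greedy_exhausts[OF w p closed] by blast
  have "length p - 1 = period * n" using total_arc_count[of p] eq W(2) by simp
  then have "p \<in> downs_first_cycles a b n"
    using walk closed greedy_hd[OF p] greedy_downs_first[OF p]
    by (simp add: downs_first_cycles_def cycle_walk_def)
  then show ?thesis using eq by blast
qed

lemma bij_betw_arc_count:
  "bij_betw arc_count (downs_first_cycles a b n) (balanced_weightings a b n)"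
proof (rule bij_betw_imageI[OF inj_on_arc_count])
  show "arc_count ` downs_first_cycles a b n = balanced_weightings a b n"
  proof (intro equalityI image_subsetI subsetI)
    fix w assume "w \<in> balanced_weightings a b n"
    then show "w \<in> arc_count ` downs_first_cycles a b n" using arc_count_surj by blast
  qed (rule arc_count_in_weightings)
qed

end

theorem theorem2:
  fixes a b n :: nat
  assumes "a > 0" and "b > 0"
  shows "(\<exists>f. bij_betw f (downs_first_cycles a b n) (balanced_weightings a b n)) \<and>
         (\<exists>g. bij_betw g (balanced_weightings a b n) (lap_cycle_sequences a b n)) \<and>
         (\<exists>h. bij_betw h (downs_first_cycles a b n) (lap_cycle_sequences a b n))"
proof -
  interpret slopes a b using assms by (rule slopes.intro)
  let ?S = "{Ps. length Ps = n \<and> set Ps \<subseteq> start_laps}"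
  have f: "bij_betw arc_count (downs_first_cycles a b n) (balanced_weightings a b n)"
    by (rule bij_betw_arc_count)
  have "bij_betw (stack roof) ?S (balanced_weightings a b n)"
    using bij_betw_stack[OF lap_fun_roof] by (simp add: hanging_roof)
  \<comment> \<open>Both \<open>stack roof\<close> and \<open>map trace\<close> start from lists of
    laps, so the former is inverted.\<close>
  then have g: "bij_betw (map trace \<circ> inv_into ?S (stack roof)) (balanced_weightings a b n)
      (lap_cycle_sequences a b n)"
    using bij_betw_trans[OF bij_betw_inv_into bij_betw_stacked_lap_cycles] by blast
  show ?thesis using f g bij_betw_trans[OF f g] by blast
qed

end
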